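(* Let $n\ge 2$ and consider a chain of $n$ spin-$1/2$'s (Hilbert space $(\mathbb{C}^2)^{\otimes n}$, dimension $d=2^n$) with periodic boundary conditions (site indices taken modulo $n$). Let $$H=\sum_{i=1}^n H_i,\qquad H_i:=H'_i+H'_{i,i+1},$$ where each $H'_i$ is a real linear combination of $\sigma^x_i,\sigma^y_i,\sigma^z_i$, and each $H'_{i,i+1}$ is a real linear combination of $\sigma^a_i\sigma^b_{i+1}$ ($a,b\in\{x,y,z\}$); in particular $\operatorname{tr}H'_i=\operatorname{tr}H'_{i,i+1}=0$ and $\operatorname{tr}(H_iH_{i'})=0$ for $i\neq i'$. Assume $H$ is translationally invariant ($H_{i+1}=TH_iT^{-1}$ for all $i$, with $T$ the cyclic translation by one site) and $\|H_i\|=1$ for all $i$. Let $\{|j\rangle\}_{j=1}^d$ be a complete orthonormal set of translationally invariant eigenstates of $H$. Let $A$ consist of spins $1,\ldots,m$ and $B$ of the rest, with $m$ even and $f:=m/n\le 1/2$, and let $\rho_{j,A}:=\operatorname{tr}_B|j\rangle\langle j|$. Then $$\bar S:=\frac{1}{d}\sum_{j=1}^d S(\rho_{j,A})\le m\ln 2-\frac{f\langle H_1^2\rangle}{4},$$ where $\langle X\rangle:=d^{-1}\operatorname{tr}X$.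
   Context: $S(\rho)=-\operatorname{tr}(\rho\ln\rho)$ is the von Neumann entropy (natural logarithm); $\|\cdot\|$ is the operator norm; $\langle X\rangle=2^{-n}\operatorname{tr}X$ is the infinite-temperature expectation value. *)

theory Defs
  imports "Jordan_Normal_Form.Matrix" "Jordan_Normal_Form.Char_Poly"
begin

(* Basis of (C^2)^{\<otimes> n}: index x < 2^n, the spin at site k (k = 0..n-1,
   i.e. paper's site k+1) is the binary digit k of x (0 = up, 1 = down). *)
definition qbit :: "nat \<Rightarrow> nat \<Rightarrow> nat" where
  "qbit x k = x div 2 ^ k mod 2"

definition pauli :: "nat \<Rightarrow> nat \<Rightarrow> nat \<Rightarrow> complex" where
  "pauli a s t =
     (if a = 0 then (if s \<noteq> t then 1 else 0)
      else if a = 1 then (if s = 0 \<and> t = 1 then - \<i> else if s = 1 \<and> t = 0 then \<i> else 0)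
      else (if s = t then (if s = 0 then 1 else -1) else 0))"

definition sigma :: "nat \<Rightarrow> nat \<Rightarrow> nat \<Rightarrow> complex mat" where
  "sigma n a i = mat (2 ^ n) (2 ^ n) (\<lambda>(r, c).
      if (\<forall>k<n. k \<noteq> i \<longrightarrow> qbit r k = qbit c k) then pauli a (qbit r i) (qbit c i) else 0)"

definition local_term :: "nat \<Rightarrow> (nat \<Rightarrow> nat \<Rightarrow> real) \<Rightarrow> (nat \<Rightarrow> nat \<Rightarrow> nat \<Rightarrow> real) \<Rightarrow> nat \<Rightarrow> complex mat" where
  "local_term n h1 h2 i = mat (2 ^ n) (2 ^ n) (\<lambda>rc.
       (\<Sum>a<3. complex_of_real (h1 i a) * sigma n a i $$ rc)
     + (\<Sum>a<3. \<Sum>b<3. complex_of_real (h2 i a b) * (sigma n a i * sigma n b ((i + 1) mod n)) $$ rc))"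

definition total_ham :: "nat \<Rightarrow> (nat \<Rightarrow> nat \<Rightarrow> real) \<Rightarrow> (nat \<Rightarrow> nat \<Rightarrow> nat \<Rightarrow> real) \<Rightarrow> complex mat" where
  "total_ham n h1 h2 = mat (2 ^ n) (2 ^ n) (\<lambda>rc. \<Sum>i<n. local_term n h1 h2 i $$ rc)"

definition shift :: "nat \<Rightarrow> nat \<Rightarrow> nat" where
  "shift n x = (\<Sum>k<n. qbit x k * 2 ^ ((k + 1) mod n))"

definition transl :: "nat \<Rightarrow> complex mat" where
  "transl n = mat (2 ^ n) (2 ^ n) (\<lambda>(r, c). if r = shift n c then 1 else 0)"

definition transl_inv :: "nat \<Rightarrow> complex mat" where
  "transl_inv n = mat (2 ^ n) (2 ^ n) (\<lambda>(r, c). if c = shift n r then 1 else 0)"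

definition vnorm :: "complex vec \<Rightarrow> real" where
  "vnorm v = sqrt (\<Sum>k<dim_vec v. (cmod (v $ k))\<^sup>2)"

definition opnorm :: "complex mat \<Rightarrow> real" where
  "opnorm M = Sup {vnorm (M *\<^sub>v v) | v. v \<in> carrier_vec (dim_col M) \<and> vnorm v \<le> 1}"

definition proj :: "complex vec \<Rightarrow> complex mat" where
  "proj v = mat (dim_vec v) (dim_vec v) (\<lambda>(r, c). v $ r * cnj (v $ c))"

(* partial trace over B = sites m..n-1 (A = sites 0..m-1 = the paper's spins 1..m) *)
definition ptrace_B :: "nat \<Rightarrow> nat \<Rightarrow> complex mat \<Rightarrow> complex mat" where
  "ptrace_B n m X = mat (2 ^ m) (2 ^ m) (\<lambda>(a, a').
      \<Sum>b<2 ^ (n - m). X $$ (a + 2 ^ m * b, a' + 2 ^ m * b))"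

definition xlnx :: "real \<Rightarrow> real" where
  "xlnx x = (if x \<le> 0 then 0 else x * ln x)"

(* von Neumann entropy S(rho) = - tr (rho ln rho) = - sum over the eigenvalues
   (with multiplicity, i.e. roots of the characteristic polynomial) of lambda ln lambda *)
definition vn_entropy :: "complex mat \<Rightarrow> real" where
  "vn_entropy \<rho> = - (\<Sum>e\<in>#proots (char_poly \<rho>). xlnx (Re e))"

definition inf_temp :: "nat \<Rightarrow> complex mat \<Rightarrow> complex" where
  "inf_temp n X = (\<Sum>k<dim_row X. X $$ (k, k)) / 2 ^ n"

end

theory Submission
  imports Defs "Jordan_Normal_Form.Schur_Decomposition"
begin

text \<open>Gibbs' variational inequality bounds the entropy of the reduced state \<open>\<rho>\<close> without subadditivity
  or Pinsker's inequality: \<open>S(\<rho>) + tr (\<rho> G) \<le> ln (tr (exp G))\<close> for every Hermitian \<open>G\<close>. Take \<open>G\<close> to be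
  \<open>\<epsilon>\<close> times the sum of the local terms on the disjoint pairs of sites \<open>(1,2), (3,4), \<dots>, (m-1,m)\<close>, where
  \<open>\<epsilon>\<close> is the energy per site of the eigenstate. By translation invariance each pair contributes
  \<open>\<epsilon>\<^sup>2\<close> to \<open>tr (\<rho> G)\<close>. The trace on the right factorizes over the pairs, and as each local term is
  traceless of norm at most 1, each factor is at most \<open>4 cosh \<epsilon> \<le> 4 exp (\<epsilon>\<^sup>2/2)\<close>. Hence
  \<open>S(\<rho>) \<le> m ln 2 - m \<epsilon>\<^sup>2/4\<close>. Averaging over the eigenbasis turns \<open>n\<^sup>2 \<epsilon>\<^sup>2\<close> into \<open>\<langle>H\<^sup>2\<rangle>\<close>, which is
  \<open>n \<langle>H\<^sub>1\<^sup>2\<rangle>\<close> by orthogonality of the local terms.\<close>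

section \<open>Spectral decomposition of Hermitian matrices\<close>

definition orthonormal_family :: "nat \<Rightarrow> nat \<Rightarrow> (nat \<Rightarrow> nat \<Rightarrow> complex) \<Rightarrow> bool" where
  "orthonormal_family N k u \<longleftrightarrow>
     (\<forall>i<k. \<forall>j<k. (\<Sum>r<N. u i r * cnj (u j r)) = (if i = j then 1 else 0))"

lemma orthonormal_familyD:
  "orthonormal_family N k u \<Longrightarrow> i < k \<Longrightarrow> j < k \<Longrightarrow>
     (\<Sum>r<N. u i r * cnj (u j r)) = (if i = j then 1 else 0)"
  by (simp add: orthonormal_family_def)

text \<open>\<open>U * V = 1\<close> expresses orthonormality of the rows of a square matrix. A
  one-sided inverse of a square matrix is two-sided, and \<open>V * U = 1\<close> is the resolution
  of the identity.\<close>

lemma orthonormal_family_complete: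
  assumes "orthonormal_family N N u" "r < N" "s < N"
  shows "(\<Sum>j<N. u j r * cnj (u j s)) = (if r = s then 1 else 0)"
proof -
  define U where "U = mat N N (\<lambda>(i, r). u i r)"
  define V where "V = mat N N (\<lambda>(r, i). cnj (u i r))"
  have "U * V = 1\<^sub>m N"
    using orthonormal_familyD[OF assms(1)]
    by (intro eq_matI) (auto simp: U_def V_def scalar_prod_def atLeast0LessThan)
  then have "V * U = 1\<^sub>m N"
    by (intro mat_mult_left_right_inverse[of U N V]) (auto simp: U_def V_def)
  then have "(V * U) $$ (s, r) = (if r = s then 1 else 0)"
    using assms by simp
  then show ?thesis
    using assms by (simp add: U_def V_def scalar_prod_def atLeast0LessThan mult.commute)
qed

text \<open>The Schur form exhibits the trace as the sum of the eigenvalues with multiplicity, which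
  would be \<open>of_nat N * L\<close> if all of them were \<open>L\<close>.\<close>

lemma exists_eigenvalue_neq:
  fixes A :: "complex mat"
  assumes A: "A \<in> carrier_mat N N" and tr: "(\<Sum>r<N. A $$ (r, r)) \<noteq> of_nat N * L"
  obtains e where "eigenvalue A e" "e \<noteq> L"
proof -
  obtain es where es: "char_poly A = (\<Prod>a\<leftarrow>es. [:- a, 1:])" "length es = N"
    using char_poly_factorized[OF A] by blast
  obtain B P Q where BPQ: "schur_decomposition A es = (B, P, Q)"
    by (cases "schur_decomposition A es") auto
  have sim: "similar_mat_wit A B P Q" and d: "diag_mat B = es"
    using schur_decomposition[OF A es(1) BPQ] by auto
  note w = similar_mat_witD2[OF A sim]
  have B: "B \<in> carrier_mat N N" and P: "P \<in> carrier_mat N N" and Q: "Q \<in> carrier_mat N N"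
    using w by auto
  have tr_comm: "(\<Sum>r<N. (X * Y) $$ (r, r)) = (\<Sum>r<N. (Y * X) $$ (r, r))"
    if "X \<in> carrier_mat N N" "Y \<in> carrier_mat N N" for X Y :: "complex mat"
  proof -
    have "(\<Sum>r<N. (X * Y) $$ (r, r)) = (\<Sum>r<N. \<Sum>s<N. X $$ (r, s) * Y $$ (s, r))"
      using that by (auto simp: scalar_prod_def atLeast0LessThan intro!: sum.cong)
    also have "\<dots> = (\<Sum>s<N. \<Sum>r<N. Y $$ (s, r) * X $$ (r, s))"
      by (subst sum.swap) (simp add: mult.commute)
    also have "\<dots> = (\<Sum>r<N. (Y * X) $$ (r, r))"
      using that by (auto simp: scalar_prod_def atLeast0LessThan intro!: sum.cong)
    finally show ?thesis .
  qed
  have "(\<Sum>r<N. A $$ (r, r)) = (\<Sum>r<N. (Q * (P * B)) $$ (r, r))"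
    using w tr_comm[of "P * B" Q] by auto
  also have "Q * (P * B) = B"
    using w by (simp flip: assoc_mult_mat[OF Q P B])
  also have "(\<Sum>r<N. B $$ (r, r)) = sum_list es"
    using B by (simp flip: d add: diag_mat_def sum_list_distinct_conv_sum_set atLeast0LessThan)
  finally have *: "sum_list es \<noteq> of_nat N * L" using tr by simp
  have "\<exists>e\<in>set es. e \<noteq> L"
  proof (rule ccontr)
    assume "\<not> ?thesis"
    then have "es = replicate N L"
      using es(2) by (metis replicate_length_same)
    then show False using * by (simp add: sum_list_replicate)
  qed
  then obtain e where "e \<in> set es" "e \<noteq> L" by blast
  moreover from this have "eigenvalue A e"
    unfolding eigenvalue_root_char_poly[OF A] es(1)
    by (auto simp: poly_prod_list o_def prod_list_zero_iff)
  ultimately show thesis using that by blast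
qed

definition herm :: "nat \<Rightarrow> (nat \<Rightarrow> nat \<Rightarrow> complex) \<Rightarrow> bool" where
  "herm N a \<longleftrightarrow> (\<forall>r<N. \<forall>s<N. a r s = cnj (a s r))"

lemma hermD: "herm N a \<Longrightarrow> r < N \<Longrightarrow> s < N \<Longrightarrow> cnj (a s r) = a r s"
  by (metis herm_def)

lemma hermI: "(\<And>r s. r < N \<Longrightarrow> s < N \<Longrightarrow> cnj (a s r) = a r s) \<Longrightarrow> herm N a"
  by (metis herm_def)

lemma herm_inner:
  assumes "herm N a"
  shows "(\<Sum>r<N. (\<Sum>s<N. a r s * v s) * cnj (w r)) = (\<Sum>r<N. v r * cnj (\<Sum>s<N. a r s * w s))"
proof -
  have "(\<Sum>r<N. (\<Sum>s<N. a r s * v s) * cnj (w r)) = (\<Sum>r<N. \<Sum>s<N. v s * cnj (a s r * w r))"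
    unfolding sum_distrib_right
    by (intro sum.cong refl) (use hermD[OF assms] in \<open>simp add: mult.commute\<close>)
  also have "\<dots> = (\<Sum>r<N. v r * cnj (\<Sum>s<N. a r s * w s))"
    by (subst sum.swap) (simp add: sum_distrib_left)
  finally show ?thesis .
qed

text \<open>A partial eigenbasis with \<open>k\<close> members, so that it can be grown by one
  vector at a time.\<close>

definition eigen_family :: "nat \<Rightarrow> (nat \<Rightarrow> nat \<Rightarrow> complex) \<Rightarrow> nat \<Rightarrow> (nat \<Rightarrow> real) \<Rightarrow> (nat \<Rightarrow> nat \<Rightarrow> complex) \<Rightarrow> bool" where
  "eigen_family N a k d u \<longleftrightarrow> orthonormal_family N k u \<and>
     (\<forall>j<k. \<forall>r<N. (\<Sum>s<N. a r s * u j s) = of_real (d j) * u j r)"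

text \<open>Deflation: adding multiples of the projections onto the known eigenvectors moves
  their eigenvalues to a common value \<open>L\<close>. When \<open>N * L\<close> differs from the trace of the
  deflated matrix, that matrix has an eigenvalue other than \<open>L\<close>, whose eigenvector is orthogonal to
  the known ones.\<close>

lemma eigen_family_extend:
  assumes h: "herm N a" and E: "eigen_family N a k d u" and k: "k < N"
  shows "\<exists>d' u'. eigen_family N a (Suc k) d' u'"
proof -
  have on: "orthonormal_family N k u"
    and ev: "\<And>j r. j < k \<Longrightarrow> r < N \<Longrightarrow> (\<Sum>s<N. a r s * u j s) = of_real (d j) * u j r"
    using E by (auto simp: eigen_family_def)
  define t where "t = (\<Sum>r<N. Re (a r r)) - (\<Sum>j<k. d j)"
  \<comment> \<open>The deflated matrix has trace \<open>t + real k * L\<close>; with this choice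
    \<open>real N * L\<close> exceeds it by exactly 1.\<close>
  define L :: real where "L = (t + 1) / (real N - real k)"
  define b where "b r s = a r s + (\<Sum>j<k. of_real (L - d j) * u j r * cnj (u j s))" for r s
  define B where "B = mat N N (\<lambda>(r, s). b r s)"
  have B: "B \<in> carrier_mat N N" by (simp add: B_def)
  have hb: "herm N b"
    by (intro hermI) (simp add: b_def hermD[OF h] mult_ac)
  have are: "a r r = of_real (Re (a r r))" if "r < N" for r
    using hermD[OF h that that] by (simp add: complex_eq_iff)
  have "(\<Sum>r<N. B $$ (r, r)) = (\<Sum>r<N. a r r) + (\<Sum>r<N. \<Sum>j<k. of_real (L - d j) * (u j r * cnj (u j r)))"
    by (simp add: B_def b_def sum.distrib mult.assoc)
  also have "(\<Sum>r<N. \<Sum>j<k. of_real (L - d j) * (u j r * cnj (u j r))) = (\<Sum>j<k. of_real (L - d j))"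
    using orthonormal_familyD[OF on]
    by (subst sum.swap) (simp flip: sum_distrib_left)
  also have "(\<Sum>r<N. a r r) = of_real (\<Sum>r<N. Re (a r r))"
    unfolding of_real_sum by (intro sum.cong refl are) auto
  finally have trB: "(\<Sum>r<N. B $$ (r, r)) = of_real (t + real k * L)"
    by (simp add: t_def sum_subtractf algebra_simps)
  have "t + real k * L \<noteq> real N * L"
  proof
    assume "t + real k * L = real N * L"
    then have "(real N - real k) * L = t" by (simp add: algebra_simps)
    then show False using k by (simp add: L_def)
  qed
  then have "(\<Sum>r<N. B $$ (r, r)) \<noteq> of_nat N * of_real L"
    unfolding trB by (metis of_real_eq_iff of_real_mult of_real_of_nat_eq)
  then obtain e where e: "eigenvalue B e" "e \<noteq> of_real L"
    using exists_eigenvalue_neq[OF B] by metis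
  then obtain v where v: "v \<in> carrier_vec N" "v \<noteq> 0\<^sub>v N" "B *\<^sub>v v = e \<cdot>\<^sub>v v"
    using B by (auto simp: eigenvalue_def eigenvector_def)
  define w where "w r = v $ r" for r
  have bw: "(\<Sum>s<N. b r s * w s) = e * w r" if "r < N" for r
  proof -
    have "(B *\<^sub>v v) $ r = e * w r" using v that by (simp add: w_def)
    then show ?thesis using v that by (simp add: B_def scalar_prod_def w_def atLeast0LessThan)
  qed
  define nw where "nw = (\<Sum>r<N. (cmod (w r))\<^sup>2)"
  have nw: "nw > 0"
  proof -
    obtain r where "r < N" "w r \<noteq> 0"
      using v(1,2) by (auto simp: w_def vec_eq_iff)
    then show ?thesis unfolding nw_def by (intro sum_pos2[of _ r]) auto
  qed
  have ww: "(\<Sum>r<N. w r * cnj (w r)) = of_real nw"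
    by (simp add: nw_def complex_norm_square del: of_real_power)
  have ereal: "cnj e = e"
  proof -
    have "e * of_real nw = cnj e * of_real nw"
    proof -
      have "(\<Sum>r<N. e * w r * cnj (w r)) = (\<Sum>r<N. w r * cnj (e * w r))"
        using herm_inner[OF hb, of w w] bw by simp
      then show ?thesis
        by (simp add: mult_ac flip: sum_distrib_left ww)
    qed
    then show ?thesis using nw by simp
  qed
  have b_apply: "(\<Sum>s<N. b r s * x s) = (\<Sum>s<N. a r s * x s) +
        (\<Sum>i<k. of_real (L - d i) * u i r * (\<Sum>s<N. x s * cnj (u i s)))" for r x
  proof -
    have "(\<Sum>s<N. b r s * x s) = (\<Sum>s<N. a r s * x s) +
        (\<Sum>s<N. \<Sum>i<k. of_real (L - d i) * u i r * cnj (u i s) * x s)"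
      unfolding b_def distrib_right sum.distrib sum_distrib_right ..
    also have "(\<Sum>s<N. \<Sum>i<k. of_real (L - d i) * u i r * cnj (u i s) * x s) =
        (\<Sum>i<k. of_real (L - d i) * u i r * (\<Sum>s<N. x s * cnj (u i s)))"
      by (subst sum.swap) (simp add: sum_distrib_left mult_ac del: of_real_diff)
    finally show ?thesis .
  qed
  have bu: "(\<Sum>s<N. b r s * u j s) = of_real L * u j r" if "j < k" "r < N" for j r
  proof -
    have "(\<Sum>i<k. of_real (L - d i) * u i r * (\<Sum>s<N. u j s * cnj (u i s))) =
        (\<Sum>i<k. of_real (L - d i) * u i r * (if j = i then 1 else 0))"
      using orthonormal_familyD[OF on \<open>j < k\<close>] by (intro sum.cong) auto
    also have "\<dots> = of_real (L - d j) * u j r"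
      using that by (simp add: if_distrib[of "\<lambda>x. _ * x"] cong: if_cong)
    finally show ?thesis using ev[OF that] b_apply[of r "u j"] by (simp add: algebra_simps)
  qed
  have orth: "(\<Sum>r<N. w r * cnj (u j r)) = 0" if "j < k" for j
  proof -
    have "(\<Sum>r<N. e * w r * cnj (u j r)) = (\<Sum>r<N. w r * cnj (of_real L * u j r))"
      using herm_inner[OF hb, of w "u j"] by (simp add: bw bu that)
    then have "(e - of_real L) * (\<Sum>r<N. w r * cnj (u j r)) = 0"
      by (simp add: algebra_simps sum_distrib_left sum_subtractf)
    then show ?thesis using e by simp
  qed
  \<comment> \<open>Orthogonality to the known eigenvectors removes the deflation terms, so
    \<open>w\<close> is an eigenvector of \<open>a\<close> itself.\<close>
  have aw: "(\<Sum>s<N. a r s * w s) = of_real (Re e) * w r" if "r < N" for r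
  proof -
    have "(\<Sum>s<N. b r s * w s) = (\<Sum>s<N. a r s * w s)"
      using b_apply[of r w] orth by simp
    moreover have "of_real (Re e) = e" using ereal by (simp add: complex_eq_iff)
    ultimately show ?thesis using bw[OF that] by simp
  qed
  define z where "z r = w r / of_real (sqrt nw)" for r
  have sq: "of_real (sqrt nw) * of_real (sqrt nw) = (of_real nw :: complex)"
    using nw by (simp flip: of_real_mult)
  have zz: "(\<Sum>r<N. z r * cnj (z r)) = 1"
    using nw ww by (simp add: z_def sq flip: sum_divide_distrib)
  have zu: "(\<Sum>r<N. z r * cnj (u j r)) = 0" if "j < k" for j
    using orth[OF that] by (simp add: z_def flip: sum_divide_distrib)
  have uz: "(\<Sum>r<N. u j r * cnj (z r)) = 0" if "j < k" for j
    using arg_cong[OF zu[OF that], of cnj] by (simp add: mult.commute)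
  have az: "(\<Sum>s<N. a r s * z s) = of_real (Re e) * z r" if "r < N" for r
    using aw[OF that] by (simp add: z_def flip: sum_divide_distrib)
  have "eigen_family N a (Suc k) (d(k := Re e)) (u(k := z))"
    using orthonormal_familyD[OF on] ev zz zu uz az
    by (auto simp: eigen_family_def orthonormal_family_def less_Suc_eq)
  then show ?thesis by blast
qed

lemma hermitian_eigenbasis:
  assumes "herm N a"
  obtains d u where "eigen_family N a N d u"
proof -
  have "k \<le> N \<Longrightarrow> \<exists>d u. eigen_family N a k d u" for k
  proof (induction k)
    case 0
    show ?case by (simp add: eigen_family_def orthonormal_family_def)
  next
    case (Suc k)
    then show ?case using eigen_family_extend[OF assms] by auto
  qed
  then show thesis using that by blast
qed

text \<open>Apply \<open>a\<close> to the resolution of the identity by its eigenvectors.\<close>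

lemma eigen_family_spectral:
  assumes "eigen_family N a N d u" "r < N" "s < N"
  shows "a r s = (\<Sum>j<N. of_real (d j) * u j r * cnj (u j s))"
proof -
  have on: "orthonormal_family N N u" using assms by (simp add: eigen_family_def)
  have "(\<Sum>j<N. of_real (d j) * u j r * cnj (u j s)) = (\<Sum>j<N. \<Sum>q<N. a r q * (u j q * cnj (u j s)))"
  proof (intro sum.cong refl)
    fix j assume "j \<in> {..<N}"
    then have "of_real (d j) * u j r = (\<Sum>q<N. a r q * u j q)"
      using assms by (simp add: eigen_family_def)
    then show "of_real (d j) * u j r * cnj (u j s) = (\<Sum>q<N. a r q * (u j q * cnj (u j s)))"
      by (simp only: sum_distrib_right mult.assoc)
  qed
  also have "\<dots> = (\<Sum>q<N. a r q * (if q = s then 1 else 0))"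
    using orthonormal_family_complete[OF on _ \<open>s < N\<close>]
    by (subst sum.swap) (simp flip: sum_distrib_left)
  also have "\<dots> = a r s"
    using assms(3) by (simp add: if_distrib[of "\<lambda>x. _ * x"] cong: if_cong)
  finally show ?thesis by simp
qed

text \<open>The eigenvectors diagonalize \<open>A\<close> by a similarity, which preserves the
  characteristic polynomial. This connects \<open>vn_entropy\<close>, defined through roots, with an
  orthonormal eigenbasis.\<close>

lemma proots_char_poly_eigen_family:
  assumes A: "A \<in> carrier_mat N N" and E: "eigen_family N (\<lambda>r s. A $$ (r, s)) N d u"
  shows "proots (char_poly A) = image_mset (\<lambda>j. of_real (d j)) (mset_set {..<N})"
proof -
  have on: "orthonormal_family N N u" using E by (simp add: eigen_family_def)
  define U where "U = mat N N (\<lambda>(r, j). u j r)"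
  define V where "V = mat N N (\<lambda>(j, r). cnj (u j r))"
  define D where "D = mat N N (\<lambda>(i, j). if i = j then complex_of_real (d j) else 0)"
  have c: "U \<in> carrier_mat N N" "V \<in> carrier_mat N N" "D \<in> carrier_mat N N"
    by (auto simp: U_def V_def D_def)
  have UV: "U * V = 1\<^sub>m N"
    using orthonormal_family_complete[OF on]
    by (intro eq_matI) (auto simp: U_def V_def scalar_prod_def atLeast0LessThan)
  have VU: "V * U = 1\<^sub>m N"
    using mat_mult_left_right_inverse[OF c(1,2) UV] .
  have "A = U * D * V"
  proof (rule eq_matI)
    fix r s assume "r < dim_row (U * D * V)" "s < dim_col (U * D * V)"
    then have rs: "r < N" "s < N" using c by auto
    have ud: "(U * D) $$ (r, j) = of_real (d j) * u j r" if "j < N" for j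
      using that rs by (simp add: U_def D_def scalar_prod_def atLeast0LessThan if_distrib[of "\<lambda>x. _ * x"] cong: if_cong)
    have "(U * D * V) $$ (r, s) = row (U * D) r \<bullet> col V s"
      using rs c by (intro index_mult_mat) auto
    also have "\<dots> = (\<Sum>j<N. (U * D) $$ (r, j) * V $$ (j, s))"
      using rs c unfolding scalar_prod_def atLeast0LessThan by (intro sum.cong) auto
    also have "\<dots> = (\<Sum>j<N. of_real (d j) * u j r * cnj (u j s))"
      using rs by (intro sum.cong) (auto simp: ud V_def)
    finally show "A $$ (r, s) = (U * D * V) $$ (r, s)"
      using eigen_family_spectral[OF E rs] by simp
  qed (use A c in auto)
  then have "similar_mat A D"
    using A c UV VU by (intro similar_matI[of _ _ U V N]) auto
  then have "char_poly A = char_poly D" by (rule char_poly_similar)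
  also have "\<dots> = (\<Prod>a\<leftarrow>diag_mat D. [:- a, 1:])"
    by (rule char_poly_upper_triangular[OF c(3)]) (auto simp: D_def)
  also have "diag_mat D = map (\<lambda>j. of_real (d j)) [0..<N]"
    by (simp add: diag_mat_def D_def)
  finally have "char_poly A = (\<Prod>j\<leftarrow>[0..<N]. [:- of_real (d j), 1:])"
    by (simp add: o_def)
  also have "\<dots> = (\<Prod>j<N. [:- of_real (d j), 1:])"
    by (simp add: prod.distinct_set_conv_list[symmetric] atLeast0LessThan)
  also have "proots \<dots> = (\<Sum>j<N. {#of_real (d j)#})"
    by (subst proots_prod) auto
  also have "\<dots> = image_mset (\<lambda>j. of_real (d j)) (mset_set {..<N})"
    by (induction N) (auto simp: lessThan_Suc)
  finally show ?thesis .
qed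

section \<open>Gibbs' variational inequality\<close>

text \<open>The expectation value of \<open>a\<close> in the vector \<open>x\<close>, which may be
  unnormalized.\<close>

definition qform :: "nat \<Rightarrow> (nat \<Rightarrow> nat \<Rightarrow> complex) \<Rightarrow> (nat \<Rightarrow> complex) \<Rightarrow> complex" where
  "qform N a x = (\<Sum>r<N. \<Sum>s<N. cnj (x r) * a r s * x s)"

lemma qform_apply: "qform N a x = (\<Sum>r<N. cnj (x r) * (\<Sum>s<N. a r s * x s))"
  by (simp add: qform_def sum_distrib_left mult.assoc)

text \<open>Stated for any sum of \<open>K\<close> weighted rank-one terms, so that it serves
  eigenbases, the slices of the reduced state and the block operators alike.\<close>

lemma qform_spectral:
  assumes "\<And>r s. r < N \<Longrightarrow> s < N \<Longrightarrow> a r s = (\<Sum>j<K. of_real (d j) * u j r * cnj (u j s))"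
  shows "qform N a x = of_real (\<Sum>j<K. d j * (cmod (\<Sum>r<N. x r * cnj (u j r)))\<^sup>2)"
proof -
  have "qform N a x = (\<Sum>r<N. \<Sum>s<N. \<Sum>j<K. of_real (d j) * (cnj (x r) * u j r * (x s * cnj (u j s))))"
    using assms by (simp add: qform_def sum_distrib_left sum_distrib_right mult_ac)
  also have "\<dots> = (\<Sum>j<K. \<Sum>r<N. \<Sum>s<N. of_real (d j) * (cnj (x r) * u j r * (x s * cnj (u j s))))"
    by (subst (2) sum.swap, subst (1) sum.swap) (simp add: sum.swap[of _ "{..<K}"])
  also have "\<dots> = (\<Sum>j<K. of_real (d j) * ((\<Sum>r<N. cnj (x r) * u j r) * (\<Sum>s<N. x s * cnj (u j s))))"
    by (simp only: sum_product, simp only: sum_distrib_left)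
  also have "\<dots> = (\<Sum>j<K. of_real (d j) * (cnj (\<Sum>r<N. x r * cnj (u j r)) * (\<Sum>s<N. x s * cnj (u j s))))"
    by simp
  also have "\<dots> = of_real (\<Sum>j<K. d j * (cmod (\<Sum>r<N. x r * cnj (u j r)))\<^sup>2)"
    by (simp add: complex_norm_square mult.commute del: of_real_power)
  finally show ?thesis .
qed

text \<open>\<open>qform_spectral\<close> for the identity matrix, whose decomposition with all
  weights 1 is the completeness relation.\<close>

lemma parseval:
  assumes "orthonormal_family N N u"
  shows "(\<Sum>j<N. (cmod (\<Sum>r<N. x r * cnj (u j r)))\<^sup>2) = (\<Sum>r<N. (cmod (x r))\<^sup>2)"
proof -
  let ?I = "\<lambda>r s. if r = s then 1 else 0 :: complex"
  have "qform N ?I x = of_real (\<Sum>j<N. 1 * (cmod (\<Sum>r<N. x r * cnj (u j r)))\<^sup>2)"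
    using orthonormal_family_complete[OF assms] by (intro qform_spectral) simp
  moreover have "qform N ?I x = of_real (\<Sum>r<N. (cmod (x r))\<^sup>2)"
    by (simp add: qform_def complex_norm_square if_distrib[of "\<lambda>x. _ * x"] if_distrib[of "\<lambda>x. x * _"]
        mult.commute del: of_real_power cong: if_cong)
  ultimately have "complex_of_real (\<Sum>j<N. (cmod (\<Sum>r<N. x r * cnj (u j r)))\<^sup>2) =
      of_real (\<Sum>r<N. (cmod (x r))\<^sup>2)"
    by simp
  then show ?thesis by (simp only: of_real_eq_iff)
qed

lemma orthonormal_family_norm:
  assumes "orthonormal_family N k u" "j < k"
  shows "(\<Sum>r<N. (cmod (u j r))\<^sup>2) = 1"
proof -
  have "complex_of_real (\<Sum>r<N. (cmod (u j r))\<^sup>2) = 1"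
    using orthonormal_familyD[OF assms assms(2)] by (simp add: complex_norm_square del: of_real_power)
  then show ?thesis by (simp only: of_real_eq_1_iff)
qed

text \<open>This is \<open>ln y \<le> y - 1\<close> at \<open>y = exp g / (Z * p)\<close>,
  multiplied by \<open>p\<close>. At \<open>p = 0\<close> the value 0 of \<open>xlnx\<close>
  applies.\<close>

lemma gibbs_pointwise:
  assumes "p \<ge> 0" "Z > 0"
  shows "- xlnx p + p * (g - ln Z) \<le> exp g / Z - p"
proof (cases "p = 0")
  case True
  then show ?thesis using assms by (simp add: xlnx_def)
next
  case False
  then have p: "p > 0" using assms by simp
  have "ln (exp g / (Z * p)) \<le> exp g / (Z * p) - 1"
    using p assms by (intro ln_le_minus_one) simp
  moreover have "ln (exp g / (Z * p)) = g - ln Z - ln p"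
    using p assms by (simp add: ln_div ln_mult)
  ultimately have "p * (g - ln Z - ln p) \<le> p * (exp g / (Z * p) - 1)"
    using p by (intro mult_left_mono) auto
  then show ?thesis using p by (simp add: xlnx_def algebra_simps)
qed

text \<open>The Hermitian \<open>G\<close> enters through its eigenbasis \<open>W\<close> and
  eigenvalues \<open>g\<close>, so no operator exponential or logarithm is formed. The squared
  overlaps of \<open>W\<close> with an eigenbasis of \<open>\<rho>\<close> form a doubly stochastic
  matrix, and averaging \<open>gibbs_pointwise\<close> with these weights makes its right-hand side
  vanish.\<close>

lemma vn_entropy_gibbs:
  fixes \<rho> :: "complex mat"
  assumes A: "\<rho> \<in> carrier_mat N N" and h: "herm N (\<lambda>r s. \<rho> $$ (r, s))"
    and psd: "\<And>x. 0 \<le> Re (qform N (\<lambda>r s. \<rho> $$ (r, s)) x)"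
    and tr: "(\<Sum>r<N. \<rho> $$ (r, r)) = 1"
    and W: "orthonormal_family N N W" and N: "N > 0"
  shows "vn_entropy \<rho> + (\<Sum>t<N. g t * Re (qform N (\<lambda>r s. \<rho> $$ (r, s)) (W t))) \<le> ln (\<Sum>t<N. exp (g t))"
proof -
  let ?a = "\<lambda>r s. \<rho> $$ (r, s)"
  obtain p u where E: "eigen_family N ?a N p u" using hermitian_eigenbasis[OF h] .
  have on: "orthonormal_family N N u" using E by (simp add: eigen_family_def)
  define \<mu> where "\<mu> t j = (cmod (\<Sum>r<N. W t r * cnj (u j r)))\<^sup>2" for t j
  have \<mu>0: "\<mu> t j \<ge> 0" for t j by (simp add: \<mu>_def)
  have \<mu>j: "(\<Sum>j<N. \<mu> t j) = 1" if "t < N" for t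
    unfolding \<mu>_def parseval[OF on] using orthonormal_family_norm[OF W that] .
  have \<mu>t: "(\<Sum>t<N. \<mu> t j) = 1" if "j < N" for j
  proof -
    have "\<mu> t j = (cmod (\<Sum>r<N. u j r * cnj (W t r)))\<^sup>2" for t
      unfolding \<mu>_def by (subst complex_mod_cnj[symmetric]) (simp add: mult.commute)
    then show ?thesis
      using parseval[OF W, of "u j"] orthonormal_family_norm[OF on that] by simp
  qed
  have qf: "Re (qform N ?a x) = (\<Sum>j<N. p j * (cmod (\<Sum>r<N. x r * cnj (u j r)))\<^sup>2)" for x
    using qform_spectral[of N ?a p u N x] eigen_family_spectral[OF E] by simp
  have p0: "p j \<ge> 0" if "j < N" for j
  proof -
    have "Re (qform N ?a (u j)) = (\<Sum>i<N. p i * (if j = i then 1 else 0))"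
      unfolding qf using orthonormal_familyD[OF on that] by (intro sum.cong) auto
    also have "\<dots> = p j" using that by (simp add: if_distrib[of "\<lambda>x. _ * x"] cong: if_cong)
    finally show ?thesis using psd by metis
  qed
  have "(\<Sum>j<N. complex_of_real (p j)) = (\<Sum>j<N. of_real (p j) * (\<Sum>r<N. u j r * cnj (u j r)))"
    using orthonormal_familyD[OF on] by simp
  also have "\<dots> = (\<Sum>r<N. \<rho> $$ (r, r))"
    using eigen_family_spectral[OF E] by (simp add: sum_distrib_left mult.assoc) (rule sum.swap)
  finally have p1: "(\<Sum>j<N. p j) = 1"
    using tr by (metis of_real_eq_1_iff of_real_sum)
  have S: "vn_entropy \<rho> = - (\<Sum>j<N. xlnx (p j))"
    unfolding vn_entropy_def proots_char_poly_eigen_family[OF A E]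
    by (simp add: sum_unfold_sum_mset image_mset.compositionality o_def)
  define Z where "Z = (\<Sum>t<N. exp (g t))"
  have Z: "Z > 0" using N by (auto simp: Z_def intro!: sum_pos)
  have "(\<Sum>t<N. \<Sum>j<N. \<mu> t j * (- xlnx (p j) + p j * (g t - ln Z))) \<le>
        (\<Sum>t<N. \<Sum>j<N. \<mu> t j * (exp (g t) / Z - p j))"
    using p0 Z \<mu>0 by (intro sum_mono mult_left_mono gibbs_pointwise) auto
  also have "\<dots> = (\<Sum>t<N. exp (g t) / Z * (\<Sum>j<N. \<mu> t j)) - (\<Sum>j<N. p j * (\<Sum>t<N. \<mu> t j))"
    by (simp add: right_diff_distrib sum_subtractf sum_distrib_left sum_divide_distrib mult.commute)
      (rule sum.swap)
  \<comment> \<open>The Boltzmann weights \<open>exp (g t) / Z\<close> and the eigenvalues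
    \<open>p j\<close> both sum to 1.\<close>
  also have "\<dots> = 0"
    using Z by (simp add: \<mu>j \<mu>t p1 Z_def flip: sum_divide_distrib)
  also have "(\<Sum>t<N. \<Sum>j<N. \<mu> t j * (- xlnx (p j) + p j * (g t - ln Z))) =
      - (\<Sum>t<N. \<Sum>j<N. \<mu> t j * xlnx (p j)) + (\<Sum>t<N. \<Sum>j<N. g t * (p j * \<mu> t j)) - (\<Sum>t<N. \<Sum>j<N. ln Z * (p j * \<mu> t j))"
    by (simp add: algebra_simps sum.distrib sum_subtractf sum_negf)
  also have "(\<Sum>t<N. \<Sum>j<N. \<mu> t j * xlnx (p j)) = (\<Sum>j<N. xlnx (p j) * (\<Sum>t<N. \<mu> t j))"
    by (subst sum.swap) (simp add: sum_distrib_left mult.commute)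
  also have "\<dots> = - vn_entropy \<rho>" by (simp add: S \<mu>t)
  also have "(\<Sum>t<N. \<Sum>j<N. ln Z * (p j * \<mu> t j)) = ln Z * (\<Sum>j<N. p j * (\<Sum>t<N. \<mu> t j))"
    by (subst sum.swap) (simp add: sum_distrib_left)
  also have "\<dots> = ln Z" by (simp add: \<mu>t p1)
  also have "(\<Sum>t<N. \<Sum>j<N. g t * (p j * \<mu> t j)) = (\<Sum>t<N. g t * Re (qform N ?a (W t)))"
    by (simp add: qf \<mu>_def sum_distrib_left)
  finally show ?thesis by (simp add: Z_def)
qed

section \<open>Exponential moments of a bounded centered spectrum\<close>

lemma sinh_le_mult_cosh:
  fixes x :: real
  assumes "x \<ge> 0"
  shows "sinh x \<le> x * cosh x"
proof -
  define f where "f y = y * cosh y - sinh y" for y :: real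
  have "f 0 \<le> f x"
  proof (rule DERIV_nonneg_imp_nondecreasing[OF assms])
    fix y :: real assume y: "0 \<le> y"
    have "(f has_real_derivative (1 * cosh y + (sinh y * 1) * y) - cosh y * 1) (at y)"
      unfolding f_def
      by (intro DERIV_diff DERIV_mult DERIV_ident has_field_derivative_cosh has_field_derivative_sinh)
    moreover have "(1 * cosh y + (sinh y * 1) * y) - cosh y * 1 \<ge> 0"
      using y by simp
    ultimately show "\<exists>D. (f has_real_derivative D) (at y) \<and> D \<ge> 0"
      by blast
  qed
  then show ?thesis by (simp add: f_def)
qed

text \<open>Compare logarithms: \<open>y\<^sup>2 / 2 - ln (cosh y)\<close> vanishes at 0 and has
  derivative \<open>y - tanh y\<close>, nonnegative for \<open>y \<ge> 0\<close> by
  \<open>sinh_le_mult_cosh\<close>. Negative arguments follow because both sides are even.\<close>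

lemma cosh_le_exp_half_square:
  fixes x :: real
  shows "cosh x \<le> exp (x\<^sup>2 / 2)"
proof -
  define f where "f y = y * y / 2 - ln (cosh y)" for y :: real
  have mono: "f 0 \<le> f y" if "y \<ge> 0" for y
  proof (rule DERIV_nonneg_imp_nondecreasing[OF that])
    fix z :: real assume z: "0 \<le> z"
    have "(f has_real_derivative (1 * z + 1 * z) / 2 - 1 / cosh z * (sinh z * 1)) (at z)"
      unfolding f_def
      by (intro DERIV_diff DERIV_mult DERIV_ident DERIV_cdivide DERIV_chain2[OF DERIV_ln_divide]
          has_field_derivative_cosh cosh_real_pos)
    moreover have "(1 * z + 1 * z) / 2 - 1 / cosh z * (sinh z * 1) \<ge> 0"
      using sinh_le_mult_cosh[OF z] by (simp add: divide_le_eq)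
    ultimately show "\<exists>D. (f has_real_derivative D) (at z) \<and> D \<ge> 0"
      by blast
  qed
  have "ln (cosh x) \<le> x\<^sup>2 / 2"
    using mono[of "\<bar>x\<bar>"] by (cases "x \<ge> 0") (simp_all add: f_def power2_eq_square)
  then have "exp (ln (cosh x)) \<le> exp (x\<^sup>2 / 2)" by (simp only: exp_le_cancel_iff)
  then show ?thesis by simp
qed

text \<open>The chord bound for the convex exponential between \<open>- b\<close> and
  \<open>b\<close>: the point \<open>b * l\<close> is the mean of \<open>b\<close> and
  \<open>- b\<close> with weights \<open>(1 + l) / 2\<close> and \<open>(1 - l) / 2\<close>.\<close>

lemma exp_mult_le_cosh_sinh:
  fixes b l :: real
  assumes "\<bar>l\<bar> \<le> 1"
  shows "exp (b * l) \<le> cosh b + l * sinh b"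
proof -
  \<comment> \<open>With these weights the deviations \<open>b - b * l\<close> and
    \<open>- b - b * l\<close> average to zero, so the tangent-line factors can be inserted for
    free.\<close>
  have "exp (b * l) = (1 + l) / 2 * (exp (b * l) * (1 + (b - b * l))) +
      (1 - l) / 2 * (exp (b * l) * (1 + (- b - b * l)))"
    by (simp add: field_simps)
  also have "\<dots> \<le> (1 + l) / 2 * (exp (b * l) * exp (b - b * l)) +
      (1 - l) / 2 * (exp (b * l) * exp (- b - b * l))"
    using assms by (intro add_mono mult_left_mono exp_ge_add_one_self) auto
  also have "\<dots> = cosh b + l * sinh b"
    by (simp add: cosh_def sinh_def field_simps flip: exp_add)
  finally show ?thesis .
qed

text \<open>Hoeffding's lemma for the uniform distribution on the values \<open>l s\<close>: the
  linear term of the chord bound cancels because they sum to zero. It bounds the partition function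
  of one block.\<close>

lemma sum_exp_centered_le:
  fixes l :: "nat \<Rightarrow> real"
  assumes "\<And>s. s < q \<Longrightarrow> \<bar>l s\<bar> \<le> 1" and "(\<Sum>s<q. l s) = 0"
  shows "(\<Sum>s<q. exp (b * l s)) \<le> real q * exp (b\<^sup>2 / 2)"
proof -
  have "(\<Sum>s<q. exp (b * l s)) \<le> (\<Sum>s<q. cosh b + l s * sinh b)"
    using assms by (intro sum_mono exp_mult_le_cosh_sinh) auto
  also have "\<dots> = real q * cosh b"
    using assms(2) by (simp add: sum.distrib flip: sum_distrib_right)
  also have "\<dots> \<le> real q * exp (b\<^sup>2 / 2)"
    by (intro mult_left_mono cosh_le_exp_half_square) simp
  finally show ?thesis .
qed

section \<open>Digits and product bases\<close>

lemma sum_lessThan_mult: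
  fixes A B :: nat
  shows "(\<Sum>x<A * B. F x) = (\<Sum>b<B. \<Sum>a<A. F (a + A * b))"
proof -
  have "(\<Sum>x<A * B. F x) = (\<Sum>b<B. sum F {b * A..<b * A + A})"
    by (simp add: sum.nat_group mult.commute)
  also have "\<dots> = (\<Sum>b<B. \<Sum>a<A. F (a + A * b))"
    using sum.shift_bounds_nat_ivl[of F 0 "_ * A" A]
    by (simp add: atLeast0LessThan add.commute mult.commute)
  finally show ?thesis .
qed

text \<open>The base is kept general: \<open>q = 2\<close> reads single spins, and
  \<open>q = 4\<close> reads pairs of neighbouring spins.\<close>

definition digit :: "nat \<Rightarrow> nat \<Rightarrow> nat \<Rightarrow> nat" where
  "digit q x k = x div q ^ k mod q"

lemma digit_less: "q > 0 \<Longrightarrow> digit q x k < q"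
  by (simp add: digit_def)

lemma digit_add_low:
  assumes "k < M"
  shows "digit q (y + q ^ M * a) k = digit q y k"
proof (cases "q = 0")
  case True
  then show ?thesis using assms by (cases k) (auto simp: digit_def)
next
  case False
  obtain j where "M = Suc (k + j)" using assms less_imp_Suc_add by blast
  then have "y + q ^ M * a = y + (q * (q ^ j * a)) * q ^ k"
    by (simp add: power_add mult_ac)
  then have "(y + q ^ M * a) div q ^ k = q * (q ^ j * a) + y div q ^ k"
    using False by (simp only: div_mult_self1) simp
  then show ?thesis by (simp add: digit_def)
qed

lemma digit_add_high:
  assumes "y < q ^ M"
  shows "digit q (y + q ^ M * a) (M + k) = digit q a k"
proof -
  have "(y + q ^ M * a) div q ^ M = a"
    using assms by (cases "q ^ M = 0") auto
  then show ?thesis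
    by (simp add: digit_def power_add div_mult2_eq)
qed

text \<open>The distributive law over tensor factors, by induction on the top digit. Inner products,
  operator products, traces and partition functions of product form all factorize through
  it.\<close>

lemma sum_prod_digit:
  fixes f :: "nat \<Rightarrow> nat \<Rightarrow> 'a::comm_semiring_1"
  shows "(\<Sum>x<q ^ M. \<Prod>k<M. f k (digit q x k)) = (\<Prod>k<M. \<Sum>a<q. f k a)"
proof (induction M)
  case 0
  show ?case by simp
next
  case (Suc M)
  have "(\<Sum>x<q ^ Suc M. \<Prod>k<Suc M. f k (digit q x k)) =
      (\<Sum>a<q. \<Sum>y<q ^ M. \<Prod>k<Suc M. f k (digit q (y + q ^ M * a) k))"
    by (simp only: power_Suc2 sum_lessThan_mult)
  also have "\<dots> = (\<Sum>a<q. \<Sum>y<q ^ M. (\<Prod>k<M. f k (digit q y k)) * f M a)"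
  proof (intro sum.cong refl)
    fix a y assume "a \<in> {..<q}" "y \<in> {..<q ^ M}"
    then have "digit q (y + q ^ M * a) M = a"
      using digit_add_high[of y q M a 0] by (simp add: digit_def)
    then show "(\<Prod>k<Suc M. f k (digit q (y + q ^ M * a) k)) = (\<Prod>k<M. f k (digit q y k)) * f M a"
      by (simp add: digit_add_low)
  qed
  also have "\<dots> = (\<Prod>k<Suc M. \<Sum>a<q. f k a)"
    by (simp add: Suc.IH flip: sum_distrib_left sum_distrib_right)
  finally show ?case .
qed

lemma digit_eqI:
  assumes "x < q ^ M" "y < q ^ M" "\<And>k. k < M \<Longrightarrow> digit q x k = digit q y k"
  shows "x = y"
  using assms
proof (induction M arbitrary: x y)
  case 0
  then show ?case by simp
next
  case (Suc M)
  have "x div q = y div q"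
  proof (rule Suc.IH)
    show "x div q < q ^ M" "y div q < q ^ M"
      using Suc.prems(1,2) by (auto simp: less_mult_imp_div_less mult.commute)
    show "digit q (x div q) k = digit q (y div q) k" if "k < M" for k
      using Suc.prems(3)[of "Suc k"] that by (simp add: digit_def div_mult2_eq)
  qed
  moreover have "x mod q = y mod q"
    using Suc.prems(3)[of 0] by (simp add: digit_def)
  ultimately show ?case by (metis div_mult_mod_eq)
qed

lemma prod_indicator:
  fixes P :: "'b \<Rightarrow> bool"
  shows "finite A \<Longrightarrow> (\<Prod>k\<in>A. if P k then 1 else 0 :: 'a::comm_semiring_1) = (if \<forall>k\<in>A. P k then 1 else 0)"
  by (induction A rule: finite_induct) auto

lemma prod_lessThan_remove:
  fixes f :: "nat \<Rightarrow> 'a::comm_monoid_mult"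
  shows "k < M \<Longrightarrow> (\<Prod>l<M. f l) = f k * (\<Prod>l\<in>{..<M} - {k}. f l)"
  by (simp add: prod.remove)

text \<open>An element of a product basis. The label \<open>t\<close> packs the \<open>M\<close>
  block labels as base-\<open>q\<close> digits, so that the basis is again indexed by the numbers
  below \<open>q ^ M\<close>.\<close>

definition prod_vec :: "nat \<Rightarrow> nat \<Rightarrow> (nat \<Rightarrow> nat \<Rightarrow> nat \<Rightarrow> complex) \<Rightarrow> nat \<Rightarrow> nat \<Rightarrow> complex" where
  "prod_vec q M v t x = (\<Prod>k<M. v k (digit q t k) (digit q x k))"

lemma prod_vec_orthonormal:
  assumes "q > 0" and on: "\<And>k. k < M \<Longrightarrow> orthonormal_family q q (v k)"
  shows "orthonormal_family (q ^ M) (q ^ M) (prod_vec q M v)"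
  unfolding orthonormal_family_def
proof (intro allI impI)
  fix t t' assume t: "t < q ^ M" "t' < q ^ M"
  have "(\<Sum>x<q ^ M. prod_vec q M v t x * cnj (prod_vec q M v t' x)) =
      (\<Sum>x<q ^ M. \<Prod>k<M. (\<lambda>k a. v k (digit q t k) a * cnj (v k (digit q t' k) a)) k (digit q x k))"
    by (simp add: prod_vec_def prod.distrib)
  also have "\<dots> = (\<Prod>k<M. \<Sum>a<q. v k (digit q t k) a * cnj (v k (digit q t' k) a))"
    by (rule sum_prod_digit)
  also have "\<dots> = (\<Prod>k<M. if digit q t k = digit q t' k then 1 else 0)"
    using orthonormal_familyD[OF on] digit_less[OF \<open>q > 0\<close>] by (intro prod.cong) auto
  also have "\<dots> = (if t = t' then 1 else 0)"
    using digit_eqI[OF t] by (auto simp: prod_indicator)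
  finally show "(\<Sum>x<q ^ M. prod_vec q M v t x * cnj (prod_vec q M v t' x)) = (if t = t' then 1 else 0)" .
qed

text \<open>The right-hand side is the matrix of \<open>b k\<close> on block \<open>k\<close>
  tensored with identities. The sum over labels factorizes: block \<open>k\<close> yields its
  spectral decomposition, every other block its completeness relation.\<close>

lemma prod_vec_spectral:
  assumes q: "q > 0" and k: "k < M"
    and E: "\<And>k. k < M \<Longrightarrow> eigen_family q (b k) q (l k) (v k)"
  shows "(\<Sum>t<q ^ M. of_real (l k (digit q t k)) * prod_vec q M v t x * cnj (prod_vec q M v t y)) =
    b k (digit q x k) (digit q y k) *
    (if \<forall>j\<in>{..<M} - {k}. digit q x j = digit q y j then 1 else 0)"
proof -
  let ?f = "\<lambda>j a. (if j = k then of_real (l k a) else 1) * (v j a (digit q x j) * cnj (v j a (digit q y j)))"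
  have "of_real (l k (digit q t k)) * prod_vec q M v t x * cnj (prod_vec q M v t y) = (\<Prod>j<M. ?f j (digit q t j))" for t
    using k by (simp add: prod_vec_def prod.distrib prod.delta')
  then have "(\<Sum>t<q ^ M. of_real (l k (digit q t k)) * prod_vec q M v t x * cnj (prod_vec q M v t y)) =
      (\<Sum>t<q ^ M. \<Prod>j<M. ?f j (digit q t j))"
    by simp
  also have "\<dots> = (\<Prod>j<M. \<Sum>a<q. ?f j a)"
    by (rule sum_prod_digit)
  also have "\<dots> = (\<Sum>a<q. ?f k a) * (\<Prod>j\<in>{..<M} - {k}. \<Sum>a<q. ?f j a)"
    using k by (rule prod_lessThan_remove)
  also have "(\<Sum>a<q. ?f k a) = b k (digit q x k) (digit q y k)"
    using eigen_family_spectral[OF E[OF k]] digit_less[OF q] by (simp add: mult.assoc)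
  also have "(\<Prod>j\<in>{..<M} - {k}. \<Sum>a<q. ?f j a) = (\<Prod>j\<in>{..<M} - {k}. if digit q x j = digit q y j then 1 else 0)"
    using orthonormal_family_complete[OF conjunct1[OF E[unfolded eigen_family_def]]] digit_less[OF q]
    by (intro prod.cong) auto
  also have "\<dots> = (if \<forall>j\<in>{..<M} - {k}. digit q x j = digit q y j then 1 else 0)"
    by (rule prod_indicator) simp
  finally show ?thesis .
qed

text \<open>The trial state in Gibbs' inequality is the product of the Gibbs states of the blocks at
  inverse temperature \<open>- \<epsilon>\<close>.\<close>

lemma vn_entropy_blocks_le:
  fixes \<rho> :: "complex mat" and l :: "nat \<Rightarrow> nat \<Rightarrow> real"
  assumes q: "q > 0"
    and A: "\<rho> \<in> carrier_mat (q ^ M) (q ^ M)" and h: "herm (q ^ M) (\<lambda>r s. \<rho> $$ (r, s))"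
    and psd: "\<And>x. 0 \<le> Re (qform (q ^ M) (\<lambda>r s. \<rho> $$ (r, s)) x)"
    and tr: "(\<Sum>r<q ^ M. \<rho> $$ (r, r)) = 1"
    and on: "\<And>k. k < M \<Longrightarrow> orthonormal_family q q (v k)"
    and l1: "\<And>k s. k < M \<Longrightarrow> s < q \<Longrightarrow> \<bar>l k s\<bar> \<le> 1"
    and l0: "\<And>k. k < M \<Longrightarrow> (\<Sum>s<q. l k s) = 0"
    and eps: "\<And>k. k < M \<Longrightarrow> (\<Sum>t<q ^ M. l k (digit q t k) *
      Re (qform (q ^ M) (\<lambda>r s. \<rho> $$ (r, s)) (prod_vec q M v t))) = \<epsilon>"
  shows "vn_entropy \<rho> \<le> real M * ln (real q) - real M * \<epsilon>\<^sup>2 / 2"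
proof -
  let ?Q = "\<lambda>t. Re (qform (q ^ M) (\<lambda>r s. \<rho> $$ (r, s)) (prod_vec q M v t))"
  \<comment> \<open>A general factor \<beta> in place of the outer \<open>\<epsilon>\<close> would
    give the bound M ln q + M \<beta>^2/2 - M \<beta> \<epsilon>, which is least at \<beta> =
    \<epsilon>.\<close>
  define g where "g t = \<epsilon> * (\<Sum>k<M. l k (digit q t k))" for t
  have "vn_entropy \<rho> + (\<Sum>t<q ^ M. g t * ?Q t) \<le> ln (\<Sum>t<q ^ M. exp (g t))"
    using q by (intro vn_entropy_gibbs A h psd tr prod_vec_orthonormal on) auto
  moreover have "(\<Sum>t<q ^ M. g t * ?Q t) = real M * \<epsilon>\<^sup>2"
  proof -
    have "(\<Sum>t<q ^ M. g t * ?Q t) = (\<Sum>t<q ^ M. \<Sum>k<M. \<epsilon> * (l k (digit q t k) * ?Q t))"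
      by (simp add: g_def sum_distrib_left sum_distrib_right mult.assoc)
    also have "\<dots> = (\<Sum>k<M. \<epsilon> * (\<Sum>t<q ^ M. l k (digit q t k) * ?Q t))"
      by (subst sum.swap) (simp add: sum_distrib_left)
    also have "\<dots> = real M * \<epsilon>\<^sup>2"
      using eps by (simp add: power2_eq_square)
    finally show ?thesis .
  qed
  moreover have "ln (\<Sum>t<q ^ M. exp (g t)) \<le> real M * (ln (real q) + \<epsilon>\<^sup>2 / 2)"
  proof -
    \<comment> \<open>The exponent is a sum over blocks, so the partition function is a product of
      block partition functions, each bounded by \<open>sum_exp_centered_le\<close>.\<close>
    have "(\<Sum>t<q ^ M. exp (g t)) = (\<Sum>t<q ^ M. \<Prod>k<M. (\<lambda>k a. exp (\<epsilon> * l k a)) k (digit q t k))"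
      by (simp add: g_def sum_distrib_left exp_sum)
    also have "\<dots> = (\<Prod>k<M. \<Sum>a<q. exp (\<epsilon> * l k a))"
      by (rule sum_prod_digit)
    also have "\<dots> \<le> (\<Prod>k<M. real q * exp (\<epsilon>\<^sup>2 / 2))"
      using l1 l0 by (intro prod_mono conjI sum_nonneg sum_exp_centered_le) auto
    also have "\<dots> = (real q * exp (\<epsilon>\<^sup>2 / 2)) ^ M" by simp
    finally have le: "(\<Sum>t<q ^ M. exp (g t)) \<le> (real q * exp (\<epsilon>\<^sup>2 / 2)) ^ M" .
    have "0 < (\<Sum>t<q ^ M. exp (g t))" using q by (intro sum_pos2[of _ 0]) auto
    then have "ln (\<Sum>t<q ^ M. exp (g t)) \<le> ln ((real q * exp (\<epsilon>\<^sup>2 / 2)) ^ M)"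
      using le by (simp add: ln_mono)
    also have "\<dots> = real M * (ln (real q) + \<epsilon>\<^sup>2 / 2)"
      using q by (simp add: ln_realpow ln_mult)
    finally show ?thesis .
  qed
  ultimately show ?thesis by (simp add: algebra_simps)
qed

section \<open>Pauli strings and the local terms\<close>

lemma qbit_eq_digit: "qbit x k = digit 2 x k"
  by (simp add: qbit_def digit_def)

text \<open>Index 3 stands for the identity, so that a one-site term is a two-site Pauli string whose second
  factor has index 3.\<close>

definition pauli' :: "nat \<Rightarrow> nat \<Rightarrow> nat \<Rightarrow> complex" where
  "pauli' a s t = (if a < 3 then pauli a s t else if s = t then 1 else 0)"

lemma pauli'_3 [simp]: "pauli' 3 s t = (if s = t then 1 else 0)"
  by (simp add: pauli'_def)

lemma cnj_pauli': "cnj (pauli' a t s) = pauli' a s t"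
  by (simp add: pauli'_def pauli_def)

lemma pauli'_trace: "a < 3 \<Longrightarrow> pauli' a 0 0 + pauli' a 1 1 = 0"
  by (simp add: pauli'_def pauli_def)

lemma sum_2: "(\<Sum>s<2. f s) = f 0 + f (Suc 0)" for f :: "nat \<Rightarrow> 'a::comm_monoid_add"
  by (simp add: numeral_2_eq_2)

definition tensor_op :: "nat \<Rightarrow> (nat \<Rightarrow> nat \<Rightarrow> nat \<Rightarrow> complex) \<Rightarrow> nat \<Rightarrow> nat \<Rightarrow> complex" where
  "tensor_op n P r c = (\<Prod>k<n. P k (digit 2 r k) (digit 2 c k))"

lemma tensor_op_mult:
  "(\<Sum>x<2 ^ n. tensor_op n P r x * tensor_op n Q x c) =
    tensor_op n (\<lambda>k s t. \<Sum>a<2. P k s a * Q k a t) r c"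
proof -
  have "(\<Sum>x<2 ^ n. tensor_op n P r x * tensor_op n Q x c) =
     (\<Sum>x<2 ^ n. \<Prod>k<n. (\<lambda>k a. P k (digit 2 r k) a * Q k a (digit 2 c k)) k (digit 2 x k))"
    by (simp add: tensor_op_def prod.distrib)
  also have "\<dots> = (\<Prod>k<n. \<Sum>a<2. P k (digit 2 r k) a * Q k a (digit 2 c k))"
    by (rule sum_prod_digit)
  finally show ?thesis by (simp add: tensor_op_def)
qed

lemma tensor_op_trace:
  "(\<Sum>x<2 ^ n. tensor_op n P x x) = (\<Prod>k<n. \<Sum>a<2. P k a a)"
  unfolding tensor_op_def by (rule sum_prod_digit[where f = "\<lambda>k a. P k a a"])

definition pstring :: "nat \<Rightarrow> nat \<Rightarrow> nat \<Rightarrow> nat \<Rightarrow> nat \<Rightarrow> nat \<Rightarrow> nat \<Rightarrow> complex" where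
  "pstring i a j b k = (if k = i then pauli' a else if k = j then pauli' b else pauli' 3)"

lemma sigma_eq_tensor_op:
  assumes "r < 2 ^ n" "c < 2 ^ n" "i < n" "a < 3"
  shows "sigma n a i $$ (r, c) = tensor_op n (\<lambda>k. if k = i then pauli' a else pauli' 3) r c"
proof -
  have "tensor_op n (\<lambda>k. if k = i then pauli' a else pauli' 3) r c =
      pauli' a (digit 2 r i) (digit 2 c i) *
      (\<Prod>k\<in>{..<n} - {i}. if digit 2 r k = digit 2 c k then 1 else 0)"
    unfolding tensor_op_def by (subst prod_lessThan_remove[OF \<open>i < n\<close>]) (simp cong: prod.cong_simp)
  then show ?thesis
    using assms by (auto simp: sigma_def qbit_eq_digit prod_indicator pauli'_def)
qed

lemma pauli'_3_mult:
  assumes "s < 2" "t < 2"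
  shows "(\<Sum>d<2. pauli' 3 s d * X d t) = X s t" "(\<Sum>d<2. X s d * pauli' 3 d t) = X s t"
  using assms by (simp_all add: if_distrib[of "\<lambda>x. x * _"] if_distrib[of "\<lambda>x. _ * x"] cong: if_cong)

text \<open>As \<open>i \<noteq> j\<close>, at every site at least one of the two factors is the
  identity, so the site-wise products are again single entries of a Pauli string.\<close>

lemma sigma_mult_eq_tensor_op:
  assumes rc: "r < 2 ^ n" "c < 2 ^ n" and ij: "i < n" "j < n" "i \<noteq> j" and ab: "a < 3" "b < 3"
  shows "(sigma n a i * sigma n b j) $$ (r, c) = tensor_op n (pstring i a j b) r c"
proof -
  have "(sigma n a i * sigma n b j) $$ (r, c) = (\<Sum>x<2 ^ n. sigma n a i $$ (r, x) * sigma n b j $$ (x, c))"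
    using rc by (simp add: sigma_def scalar_prod_def atLeast0LessThan)
  also have "\<dots> = (\<Sum>x<2 ^ n. tensor_op n (\<lambda>k. if k = i then pauli' a else pauli' 3) r x *
      tensor_op n (\<lambda>k. if k = j then pauli' b else pauli' 3) x c)"
    using assms by (simp add: sigma_eq_tensor_op)
  also have "\<dots> = tensor_op n (\<lambda>k s t. \<Sum>d<2. (if k = i then pauli' a else pauli' 3) s d *
      (if k = j then pauli' b else pauli' 3) d t) r c"
    by (rule tensor_op_mult)
  also have "\<dots> = tensor_op n (pstring i a j b) r c"
    unfolding tensor_op_def
  proof (intro prod.cong refl)
    fix k
    have "digit 2 r k < 2" "digit 2 c k < 2" by (simp_all add: digit_less)
    then show "(\<Sum>d<2. (if k = i then pauli' a else pauli' 3) (digit 2 r k) d *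
      (if k = j then pauli' b else pauli' 3) d (digit 2 c k)) =
      pstring i a j b k (digit 2 r k) (digit 2 c k)"
      using \<open>i \<noteq> j\<close>
      by (cases "k = i"; cases "k = j") (simp_all only: pstring_def if_True if_False pauli'_3_mult)
  qed
  finally show ?thesis .
qed

text \<open>The field coefficients sit at \<open>b = 3\<close>, the index of the identity, so that
  one double sum covers one-site and two-site terms.\<close>

definition lcoef :: "(nat \<Rightarrow> nat \<Rightarrow> real) \<Rightarrow> (nat \<Rightarrow> nat \<Rightarrow> nat \<Rightarrow> real) \<Rightarrow> nat \<Rightarrow> nat \<Rightarrow> nat \<Rightarrow> complex" where
  "lcoef h1 h2 i a b = complex_of_real (if b = 3 then h1 i a else h2 i a b)"

text \<open>\<open>n \<ge> 2\<close> makes the neighbour \<open>(i + 1) mod n\<close> a site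
  different from \<open>i\<close>, so each product of two Pauli operators is a genuine two-site
  string.\<close>

lemma local_term_eq_tensor_op:
  assumes n: "n \<ge> 2" and i: "i < n" and rc: "r < 2 ^ n" "c < 2 ^ n"
  shows "local_term n h1 h2 i $$ (r, c) =
    (\<Sum>a<3. \<Sum>b<4. lcoef h1 h2 i a b * tensor_op n (pstring i a ((i + 1) mod n) b) r c)"
proof -
  define j where "j = (i + 1) mod n"
  have j: "j < n" "i \<noteq> j"
    using n i by (auto simp: j_def mod_Suc)
  have b4: "(\<Sum>b<4. f b) = f 3 + (\<Sum>b<3. f b)" for f :: "nat \<Rightarrow> complex"
    by (simp add: numeral_eq_Suc add.commute)
  have p3: "pstring i a j 3 = (\<lambda>k. if k = i then pauli' a else pauli' 3)" for a
    by (auto simp: pstring_def fun_eq_iff)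
  have "local_term n h1 h2 i $$ (r, c) =
     (\<Sum>a<3. complex_of_real (h1 i a) * tensor_op n (\<lambda>k. if k = i then pauli' a else pauli' 3) r c)
     + (\<Sum>a<3. \<Sum>b<3. complex_of_real (h2 i a b) * tensor_op n (pstring i a j b) r c)"
    unfolding local_term_def using i j rc
    by (simp add: sigma_eq_tensor_op sigma_mult_eq_tensor_op flip: j_def[simplified])
  also have "\<dots> = (\<Sum>a<3. \<Sum>b<4. lcoef h1 h2 i a b * tensor_op n (pstring i a j b) r c)"
    by (simp add: b4 p3 lcoef_def sum.distrib)
  finally show ?thesis by (simp add: j_def)
qed

lemma tensor_op_pstring:
  assumes "i < n" "j < n" "i \<noteq> j"
  shows "tensor_op n (pstring i a j b) r c =
    pauli' a (digit 2 r i) (digit 2 c i) * pauli' b (digit 2 r j) (digit 2 c j) *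
    (if \<forall>k\<in>{..<n} - {i, j}. digit 2 r k = digit 2 c k then 1 else 0)"
proof -
  let ?F = "\<lambda>k. pstring i a j b k (digit 2 r k) (digit 2 c k)"
  have "tensor_op n (pstring i a j b) r c = ?F i * (?F j * prod ?F ({..<n} - {i} - {j}))"
    using assms by (simp add: tensor_op_def prod.remove[of _ i] prod.remove[of _ j])
  also have "{..<n} - {i} - {j} = {..<n} - {i, j}" by auto
  also have "prod ?F ({..<n} - {i, j}) = (\<Prod>k\<in>{..<n} - {i, j}. if digit 2 r k = digit 2 c k then 1 else 0)"
    by (intro prod.cong) (auto simp: pstring_def)
  finally show ?thesis
    using assms by (simp add: prod_indicator mult.assoc) (simp add: pstring_def)
qed

text \<open>The local term as a 4-by-4 matrix on its own two sites. The low bit of an index is the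
  spin at site \<open>i\<close>, the high bit that of its right neighbour.\<close>

definition block :: "(nat \<Rightarrow> nat \<Rightarrow> real) \<Rightarrow> (nat \<Rightarrow> nat \<Rightarrow> nat \<Rightarrow> real) \<Rightarrow> nat \<Rightarrow> nat \<Rightarrow> nat \<Rightarrow> complex" where
  "block h1 h2 i s t = (\<Sum>a<3. \<Sum>b<4. lcoef h1 h2 i a b *
     (pauli' a (digit 2 s 0) (digit 2 t 0) * pauli' b (digit 2 s 1) (digit 2 t 1)))"

lemma local_term_eq_block:
  assumes n: "n \<ge> 2" and i: "i < n" and rc: "r < 2 ^ n" "c < 2 ^ n" and j: "j = (i + 1) mod n"
    and st: "digit 2 s 0 = digit 2 r i" "digit 2 s 1 = digit 2 r j"
            "digit 2 t 0 = digit 2 c i" "digit 2 t 1 = digit 2 c j"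
  shows "local_term n h1 h2 i $$ (r, c) = block h1 h2 i s t *
    (if \<forall>k\<in>{..<n} - {i, j}. digit 2 r k = digit 2 c k then 1 else 0)"
proof -
  have "j < n" "i \<noteq> j"
    using n i by (auto simp: j mod_Suc)
  then show ?thesis
    unfolding local_term_eq_tensor_op[OF n i rc] block_def st j[symmetric]
    using i by (simp add: tensor_op_pstring sum_distrib_right)
qed

lemma herm_block: "herm 4 (block h1 h2 i)"
  by (intro hermI) (simp add: block_def lcoef_def cnj_pauli')

text \<open>Every string in a local term has a proper Pauli matrix as its first factor, and that
  factor is traceless.\<close>

lemma block_trace: "(\<Sum>s<4. block h1 h2 i s s) = 0"
proof -
  have s4: "(\<Sum>s<4. f s) = f 0 + f 1 + f 2 + f 3" for f :: "nat \<Rightarrow> complex"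
    by (simp add: numeral_eq_Suc add.assoc)
  have digits: "digit 2 0 k = 0" "digit 2 1 0 = 1" "digit 2 1 1 = 0" "digit 2 2 0 = 0"
      "digit 2 2 1 = 1" "digit 2 3 0 = 1" "digit 2 3 1 = 1" for k
    by (simp_all add: digit_def)
  let ?F = "\<lambda>a b s. lcoef h1 h2 i a b *
     (pauli' a (digit 2 s 0) (digit 2 s 0) * pauli' b (digit 2 s 1) (digit 2 s 1))"
  have F: "(\<Sum>s<4. ?F a b s) = 0" if "a < 3" for a b
  proof -
    have "(\<Sum>s<4. ?F a b s) = lcoef h1 h2 i a b *
        ((pauli' a 0 0 + pauli' a 1 1) * (pauli' b 0 0 + pauli' b 1 1))"
      unfolding s4 digits by (simp only: algebra_simps)
    then show ?thesis by (simp only: pauli'_trace[OF that] mult_zero_left mult_zero_right)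
  qed
  have "(\<Sum>s<4. block h1 h2 i s s) = (\<Sum>a<3. \<Sum>s<4. \<Sum>b<4. ?F a b s)"
    unfolding block_def by (rule sum.swap)
  also have "\<dots> = (\<Sum>a<3. \<Sum>b<4. \<Sum>s<4. ?F a b s)"
    by (intro sum.cong refl sum.swap)
  also have "\<dots> = 0"
    by (intro sum.neutral ballI F) simp
  finally show ?thesis .
qed

section \<open>The operator norm and the eigenvalues of a block\<close>

lemma vnorm_sq: "(vnorm v)\<^sup>2 = (\<Sum>k<dim_vec v. (cmod (v $ k))\<^sup>2)"
  by (simp add: vnorm_def sum_nonneg)

lemma vnorm_nonneg: "vnorm v \<ge> 0"
  by (simp add: vnorm_def sum_nonneg)

lemma cmod_index_le_vnorm: "k < dim_vec v \<Longrightarrow> cmod (v $ k) \<le> vnorm v"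
  unfolding vnorm_def by (intro real_le_rsqrt member_le_sum) auto

text \<open>A real supremum bounds its members once the set is bounded: on the unit ball every
  coordinate of a vector has modulus at most 1, so the absolute row sums of \<open>M\<close> control
  the image.\<close>

lemma vnorm_mult_le_opnorm:
  assumes "v \<in> carrier_vec (dim_col M)" "vnorm v \<le> 1"
  shows "vnorm (M *\<^sub>v v) \<le> opnorm M"
  unfolding opnorm_def
proof (rule cSup_upper)
  show "vnorm (M *\<^sub>v v) \<in> {vnorm (M *\<^sub>v v) |v. v \<in> carrier_vec (dim_col M) \<and> vnorm v \<le> 1}"
    using assms by blast
  show "bdd_above {vnorm (M *\<^sub>v v) |v. v \<in> carrier_vec (dim_col M) \<and> vnorm v \<le> 1}"
  proof (rule bdd_aboveI, safe)
    fix w assume w: "w \<in> carrier_vec (dim_col M)" "vnorm w \<le> 1"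
    have "cmod ((M *\<^sub>v w) $ r) \<le> (\<Sum>c<dim_col M. cmod (M $$ (r, c)))" if "r < dim_row M" for r
    proof -
      have "(M *\<^sub>v w) $ r = (\<Sum>c<dim_col M. M $$ (r, c) * w $ c)"
        using that w by (simp add: scalar_prod_def atLeast0LessThan)
      also have "cmod \<dots> \<le> (\<Sum>c<dim_col M. cmod (M $$ (r, c) * w $ c))"
        by (rule norm_sum)
      also have "\<dots> \<le> (\<Sum>c<dim_col M. cmod (M $$ (r, c)))"
      proof (rule sum_mono)
        fix c assume "c \<in> {..<dim_col M}"
        then have "cmod (w $ c) \<le> 1" using w cmod_index_le_vnorm[of c w] by simp
        then show "cmod (M $$ (r, c) * w $ c) \<le> cmod (M $$ (r, c))"
          by (simp add: norm_mult mult_left_le)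
      qed
      finally show ?thesis .
    qed
    then show "vnorm (M *\<^sub>v w) \<le> sqrt (\<Sum>r<dim_row M. (\<Sum>c<dim_col M. cmod (M $$ (r, c)))\<^sup>2)"
      unfolding vnorm_def by (intro real_sqrt_le_mono) (auto intro!: sum_mono power_mono)
  qed
qed

lemma local_term_carrier [simp]:
  "local_term n h1 h2 i \<in> carrier_mat (2 ^ n) (2 ^ n)"
  "dim_row (local_term n h1 h2 i) = 2 ^ n" "dim_col (local_term n h1 h2 i) = 2 ^ n"
  by (simp_all add: local_term_def)

lemma digit_shifted:
  "digit 2 (t * 2 ^ i) k = (if k < i then 0 else digit 2 t (k - i))"
proof (cases "k < i")
  case True
  then obtain j where "i = Suc (k + j)" using less_imp_Suc_add by blast
  then have "t * 2 ^ i = 2 ^ k * (2 * (2 ^ j * t))"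
    by (simp add: power_add mult_ac)
  then have "t * 2 ^ i div 2 ^ k = 2 * (2 ^ j * t)"
    by (simp only: nonzero_mult_div_cancel_left power_not_zero zero_neq_numeral not_False_eq_True)
  then show ?thesis using True by (simp add: digit_def)
next
  case False
  then have "t * 2 ^ i div 2 ^ k = t div 2 ^ (k - i)"
    by (metis div_mult_mult2 le_add_diff_inverse2 linorder_not_less power_add power_not_zero zero_neq_numeral)
  then show ?thesis using False by (simp add: digit_def)
qed

lemma digit_2_ge:
  assumes "x < 2 ^ M" "M \<le> k"
  shows "digit 2 x k = 0"
proof -
  have "x < 2 ^ k" using assms by (meson less_le_trans one_le_numeral power_increasing)
  then show ?thesis by (simp add: digit_def)
qed

text \<open>Setting all spins outside the pair to 0 selects a submatrix equal to the block;
  \<open>s * 2 ^ i\<close> places the two bits of \<open>s\<close> at sites \<open>i\<close> and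
  \<open>i + 1\<close>.\<close>

lemma local_term_submatrix:
  assumes "i + 1 < n" "s < 4" "t < 4"
  shows "local_term n h1 h2 i $$ (s * 2 ^ i, t * 2 ^ i) = block h1 h2 i s t"
    and "s * 2 ^ i < 2 ^ n"
proof -
  have lt: "u * 2 ^ i < 2 ^ n" if "u < 4" for u :: nat
  proof -
    have "u * 2 ^ i < 4 * 2 ^ i" using that by simp
    also have "\<dots> = 2 ^ (i + 2)" by (simp add: power_add)
    also have "\<dots> \<le> (2::nat) ^ n" using assms by (intro power_increasing) auto
    finally show ?thesis .
  qed
  then show "s * 2 ^ i < 2 ^ n" using assms by blast
  have 0: "digit 2 (u * 2 ^ i) k = 0" if "u < 4" "k \<in> {..<n} - {i, i + 1}" for u k
  proof (cases "k < i")
    case False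
    then have "k - i \<ge> 2" using that by auto
    then have "digit 2 u (k - i) = 0" using that by (intro digit_2_ge[of u 2]) auto
    then show ?thesis using False by (simp add: digit_shifted)
  qed (simp add: digit_shifted)
  have "local_term n h1 h2 i $$ (s * 2 ^ i, t * 2 ^ i) = block h1 h2 i s t *
    (if \<forall>k\<in>{..<n} - {i, i + 1}. digit 2 (s * 2 ^ i) k = digit 2 (t * 2 ^ i) k then 1 else 0)"
    using assms lt by (intro local_term_eq_block) (auto simp: digit_shifted)
  then show "local_term n h1 h2 i $$ (s * 2 ^ i, t * 2 ^ i) = block h1 h2 i s t"
    using 0 assms by simp
qed

text \<open>Embed the block eigenvector into the chain with all other spins 0. On the embedded
  coordinates the local term multiplies this unit vector by \<open>l s\<close>, so its operator norm
  is at least \<open>\<bar>l s\<bar>\<close>.\<close>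

lemma block_eigenvalue_le:
  assumes i: "i + 1 < n" and E: "eigen_family 4 (block h1 h2 i) 4 l v" and s: "s < 4"
    and op: "opnorm (local_term n h1 h2 i) \<le> 1"
  shows "\<bar>l s\<bar> \<le> 1"
proof -
  define emb where "emb t = t * 2 ^ i" for t :: nat
  define V where "V = vec (2 ^ n) (\<lambda>x. if x \<in> emb ` {..<4} then v s (x div 2 ^ i) else 0)"
  have inj: "inj_on emb {..<4}" by (auto simp: inj_on_def emb_def)
  have emb: "emb ` {..<4} \<subseteq> {..<2 ^ n}"
    using local_term_submatrix(2)[OF i] by (auto simp: emb_def)
  have Vemb: "V $ emb t = v s t" if "t < 4" for t
    using that emb by (auto simp: V_def emb_def)
  have sum_emb: "(\<Sum>x<2 ^ n. G x) = (\<Sum>t<4. G (emb t))"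
    if "\<And>x. x < 2 ^ n \<Longrightarrow> x \<notin> emb ` {..<4} \<Longrightarrow> G x = 0" for G :: "nat \<Rightarrow> 'z::comm_monoid_add"
  proof -
    have "(\<Sum>x<2 ^ n. G x) = sum G (emb ` {..<4})"
      using emb that by (intro sum.mono_neutral_right) auto
    then show ?thesis by (simp add: sum.reindex[OF inj])
  qed
  have on: "(\<Sum>t<4. (cmod (v s t))\<^sup>2) = 1"
    using orthonormal_family_norm[OF _ s] E by (simp add: eigen_family_def)
  have "(\<Sum>x<2 ^ n. (cmod (V $ x))\<^sup>2) = (\<Sum>t<4. (cmod (V $ emb t))\<^sup>2)"
    by (intro sum_emb) (auto simp: V_def)
  then have "(vnorm V)\<^sup>2 = 1"
    using on Vemb by (simp add: vnorm_sq V_def)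
  then have V1: "vnorm V \<le> 1"
    using vnorm_nonneg[of V] by (metis order_refl power2_eq_1_iff abs_of_nonneg abs_1 abs_minus)
  have HV: "(local_term n h1 h2 i *\<^sub>v V) $ emb t = of_real (l s) * v s t" if t: "t < 4" for t
  proof -
    have "(local_term n h1 h2 i *\<^sub>v V) $ emb t = (\<Sum>x<2 ^ n. local_term n h1 h2 i $$ (emb t, x) * V $ x)"
      using emb t by (auto simp: scalar_prod_def atLeast0LessThan V_def)
    also have "\<dots> = (\<Sum>u<4. local_term n h1 h2 i $$ (emb t, emb u) * V $ emb u)"
      by (intro sum_emb) (auto simp: V_def)
    also have "\<dots> = (\<Sum>u<4. block h1 h2 i t u * v s u)"
      using Vemb local_term_submatrix(1)[OF i t] by (intro sum.cong) (auto simp: emb_def)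
    also have "\<dots> = of_real (l s) * v s t"
      using E s t by (simp add: eigen_family_def)
    finally show ?thesis .
  qed
  have "(l s)\<^sup>2 = (\<Sum>t<4. (cmod ((local_term n h1 h2 i *\<^sub>v V) $ emb t))\<^sup>2)"
    using on HV by (simp add: norm_mult power_mult_distrib flip: sum_distrib_left)
  also have "\<dots> = (\<Sum>x\<in>emb ` {..<4}. (cmod ((local_term n h1 h2 i *\<^sub>v V) $ x))\<^sup>2)"
    by (simp add: sum.reindex[OF inj])
  \<comment> \<open>Restricting the image to the embedded coordinates can only shrink its
    norm.\<close>
  also have "\<dots> \<le> (vnorm (local_term n h1 h2 i *\<^sub>v V))\<^sup>2"
    unfolding vnorm_sq using emb by (intro sum_mono2) auto
  also have "\<dots> \<le> (opnorm (local_term n h1 h2 i))\<^sup>2"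
    using V1 by (intro power_mono vnorm_mult_le_opnorm vnorm_nonneg) (auto simp: V_def)
  also have "\<dots> \<le> 1"
    using op order_trans[OF vnorm_nonneg vnorm_mult_le_opnorm[OF _ V1, of "local_term n h1 h2 i"]]
    by (intro power_le_one) (auto simp: V_def)
  finally show ?thesis by (simp add: abs_square_le_1)
qed

section \<open>Pairs of neighbouring sites as base-4 digits\<close>

lemma digit_4_2: "digit 2 (digit 4 x (k div 2)) (k mod 2) = digit 2 x k"
proof -
  have "x div 2 ^ k = x div 4 ^ (k div 2) div 2 ^ (k mod 2)"
  proof -
    have "(2::nat) ^ k = 2 ^ (2 * (k div 2) + k mod 2)" by simp
    also have "\<dots> = 4 ^ (k div 2) * 2 ^ (k mod 2)" by (simp only: power_add power_mult) simp
    finally show ?thesis by (simp only: div_mult2_eq)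
  qed
  moreover have "y mod 4 div 2 ^ (k mod 2) mod 2 = y div 2 ^ (k mod 2) mod 2" for y :: nat
  proof -
    have "y mod 4 = y mod 2 + 2 * (y div 2 mod 2)"
      using mod_mult2_eq[of y 2 2] by simp
    then have "y mod 4 div 2 mod 2 = y div 2 mod 2" "y mod 4 mod 2 = y mod 2" by simp_all
    moreover have "k mod 2 = 0 \<or> k mod 2 = 1" by presburger
    ultimately show ?thesis by (elim disjE) (simp_all only: power_0 power_one_right div_by_1)
  qed
  ultimately show ?thesis by (simp add: digit_def)
qed

lemma digit_4_eq_iff:
  "digit 4 x j = digit 4 y j \<longleftrightarrow>
    digit 2 x (2 * j) = digit 2 y (2 * j) \<and> digit 2 x (2 * j + 1) = digit 2 y (2 * j + 1)"
proof
  assume "digit 4 x j = digit 4 y j"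
  then show "digit 2 x (2 * j) = digit 2 y (2 * j) \<and> digit 2 x (2 * j + 1) = digit 2 y (2 * j + 1)"
    using digit_4_2[of x "2 * j"] digit_4_2[of y "2 * j"]
      digit_4_2[of x "2 * j + 1"] digit_4_2[of y "2 * j + 1"] by simp
next
  assume *: "digit 2 x (2 * j) = digit 2 y (2 * j) \<and> digit 2 x (2 * j + 1) = digit 2 y (2 * j + 1)"
  show "digit 4 x j = digit 4 y j"
  proof (rule digit_eqI[of _ 2 2])
    fix k :: nat assume "k < 2"
    then show "digit 2 (digit 4 x j) k = digit 2 (digit 4 y j) k"
      using * digit_4_2[of x "2 * j + k"] digit_4_2[of y "2 * j + k"]
      by (auto simp: less_2_cases_iff)
  qed (use digit_less[of 4] in auto)
qed

text \<open>Sites \<open>2 * k\<close> and \<open>2 * k + 1\<close> are the two bits of base-4 digit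
  \<open>k\<close>, so the term acts within one block. The numbers \<open>b\<close> and
  \<open>c\<close> encode the sites from \<open>2 * M\<close> on, where it is the identity.\<close>

lemma local_term_even_site:
  assumes k: "k < M" and M: "2 * M \<le> n"
    and x: "x < 4 ^ M" "y < 4 ^ M" and b: "b < 2 ^ (n - 2 * M)" "c < 2 ^ (n - 2 * M)"
  shows "local_term n h1 h2 (2 * k) $$ (x + 4 ^ M * b, y + 4 ^ M * c) =
     block h1 h2 (2 * k) (digit 4 x k) (digit 4 y k) *
     (if \<forall>j\<in>{..<M} - {k}. digit 4 x j = digit 4 y j then 1 else 0) * (if b = c then 1 else 0)"
proof -
  have pw: "(4::nat) ^ M = 2 ^ (2 * M)" by (simp add: power_mult)
  have n: "(2::nat) ^ n = 4 ^ M * 2 ^ (n - 2 * M)" using M by (simp add: pw flip: power_add)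
  have lt: "u + 4 ^ M * d < 2 ^ n" if "u < 4 ^ M" "d < 2 ^ (n - 2 * M)" for u d :: nat
  proof -
    have "u + 4 ^ M * d < 4 ^ M * Suc d" using that by simp
    also have "\<dots> \<le> 4 ^ M * 2 ^ (n - 2 * M)" using that by (intro mult_left_mono) auto
    finally show ?thesis by (simp only: n)
  qed
  have low: "digit 2 (u + 4 ^ M * d) j = digit 2 u j" if "j < 2 * M" for u d j
    using digit_add_low[OF that, of 2 u d] by (simp only: pw)
  have high: "digit 2 (u + 4 ^ M * d) (2 * M + j) = digit 2 d j" if "u < 4 ^ M" for u d j
    using digit_add_high[of u 2 "2 * M" d j] that by (simp only: pw)
  have "(\<forall>j\<in>{..<n} - {2 * k, 2 * k + 1}. digit 2 (x + 4 ^ M * b) j = digit 2 (y + 4 ^ M * c) j) \<longleftrightarrow>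
     (\<forall>j\<in>{..<M} - {k}. digit 4 x j = digit 4 y j) \<and> b = c" (is "?L \<longleftrightarrow> ?R")
  proof
    assume L: ?L
    have "digit 4 x j = digit 4 y j" if "j < M" "j \<noteq> k" for j
    proof -
      have "2 * j \<in> {..<n} - {2 * k, 2 * k + 1}" "2 * j + 1 \<in> {..<n} - {2 * k, 2 * k + 1}"
        using that M by auto
      then show ?thesis
        using L low[of "2 * j" x b] low[of "2 * j" y c] low[of "2 * j + 1" x b] low[of "2 * j + 1" y c] that
        unfolding digit_4_eq_iff by simp
    qed
    moreover have "b = c"
    proof (rule digit_eqI[OF b])
      fix j assume "j < n - 2 * M"
      then have "2 * M + j \<in> {..<n} - {2 * k, 2 * k + 1}" using k by auto
      then show "digit 2 b j = digit 2 c j"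
        using L high[OF x(1), of b j] high[OF x(2), of c j] by metis
    qed
    ultimately show ?R by auto
  next
    assume R: ?R
    show ?L
    proof
      fix j assume j: "j \<in> {..<n} - {2 * k, 2 * k + 1}"
      show "digit 2 (x + 4 ^ M * b) j = digit 2 (y + 4 ^ M * c) j"
      proof (cases "j < 2 * M")
        case True
        moreover have "j div 2 \<in> {..<M} - {k}" using True j by auto
        ultimately show ?thesis
          using R low digit_4_2[of x j] digit_4_2[of y j] by metis
      next
        case False
        then obtain j' where "j = 2 * M + j'" by (metis le_add_diff_inverse linorder_not_less)
        then show ?thesis using R high x by metis
      qed
    qed
  qed
  moreover have "local_term n h1 h2 (2 * k) $$ (x + 4 ^ M * b, y + 4 ^ M * c) =
    block h1 h2 (2 * k) (digit 4 x k) (digit 4 y k) *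
    (if \<forall>j\<in>{..<n} - {2 * k, 2 * k + 1}. digit 2 (x + 4 ^ M * b) j = digit 2 (y + 4 ^ M * c) j then 1 else 0)"
    using k M x b lt digit_4_2[of x "2 * k"] digit_4_2[of y "2 * k"]
      digit_4_2[of x "2 * k + 1"] digit_4_2[of y "2 * k + 1"]
    by (intro local_term_eq_block) (auto simp: low)
  ultimately show ?thesis by simp
qed

section \<open>The reduced state\<close>

text \<open>The unnormalized component of \<open>\<psi>\<close> in A when B is in the basis state
  \<open>b\<close>; \<open>N\<close> is the dimension of A, whose sites are the low-order
  digits.\<close>

definition slice :: "nat \<Rightarrow> complex vec \<Rightarrow> nat \<Rightarrow> nat \<Rightarrow> complex" where
  "slice N \<psi> b a = \<psi> $ (a + N * b)"

text \<open>The reduced state is the sum of the rank-one operators of the slices, from which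
  hermiticity and positivity are evident.\<close>

lemma ptrace_B_proj:
  assumes "\<psi> \<in> carrier_vec (2 ^ n)" "m \<le> n" "a < 2 ^ m" "a' < 2 ^ m"
  shows "ptrace_B n m (proj \<psi>) $$ (a, a') =
    (\<Sum>b<2 ^ (n - m). slice (2 ^ m) \<psi> b a * cnj (slice (2 ^ m) \<psi> b a'))"
proof -
  have n: "(2::nat) ^ n = 2 ^ m * 2 ^ (n - m)" using assms by (simp flip: power_add)
  have "u + 2 ^ m * d < 2 ^ n" if "u < 2 ^ m" "d < 2 ^ (n - m)" for u d :: nat
  proof -
    have "u + 2 ^ m * d < 2 ^ m * Suc d" using that by simp
    also have "\<dots> \<le> 2 ^ m * 2 ^ (n - m)" using that by (intro mult_left_mono) auto
    finally show ?thesis by (simp only: n)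
  qed
  then show ?thesis
    using assms by (auto simp: ptrace_B_def proj_def slice_def intro!: sum.cong)
qed

text \<open>The term acts on A alone, so the form on the chain splits over the slices, and each part
  is evaluated in the product eigenbasis of the blocks. The result is visibly real.\<close>

lemma qform_local_term:
  assumes k: "k < M" and M: "2 * M \<le> n"
    and E: "\<And>j. j < M \<Longrightarrow> eigen_family 4 (block h1 h2 (2 * j)) 4 (l j) (v j)"
  shows "qform (2 ^ n) (\<lambda>r c. local_term n h1 h2 (2 * k) $$ (r, c)) (\<lambda>x. \<psi> $ x) =
    of_real (\<Sum>t<4 ^ M. l k (digit 4 t k) * (\<Sum>b<2 ^ (n - 2 * M).
      (cmod (\<Sum>a<4 ^ M. slice (4 ^ M) \<psi> b a * cnj (prod_vec 4 M v t a)))\<^sup>2))"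
proof -
  let ?A = "4 ^ M :: nat" and ?B = "2 ^ (n - 2 * M) :: nat"
  let ?L = "\<lambda>r c. local_term n h1 h2 (2 * k) $$ (r, c)"
  define G where "G x y = (\<Sum>t<?A. of_real (l k (digit 4 t k)) * prod_vec 4 M v t x * cnj (prod_vec 4 M v t y))" for x y
  have n: "(2::nat) ^ n = ?A * ?B"
  proof -
    have "?A * ?B = 2 ^ (2 * M) * 2 ^ (n - 2 * M)" by (simp add: power_mult)
    also have "\<dots> = 2 ^ n" using M by (simp flip: power_add)
    finally show ?thesis ..
  qed
  have L: "?L (x + ?A * b) (y + ?A * c) = G x y * (if b = c then 1 else 0)"
    if "x < ?A" "y < ?A" "b < ?B" "c < ?B" for x y b c
    unfolding local_term_even_site[OF k M that] G_def
    by (subst prod_vec_spectral[OF _ k E]) auto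
  have "qform (2 ^ n) ?L (\<lambda>x. \<psi> $ x) =
     (\<Sum>b<?B. \<Sum>x<?A. \<Sum>c<?B. \<Sum>y<?A. cnj (slice ?A \<psi> b x) * ?L (x + ?A * b) (y + ?A * c) * slice ?A \<psi> c y)"
    unfolding qform_def n sum_lessThan_mult slice_def ..
  also have "\<dots> = (\<Sum>b<?B. \<Sum>x<?A. \<Sum>c<?B. if b = c then
      (\<Sum>y<?A. cnj (slice ?A \<psi> b x) * G x y * slice ?A \<psi> c y) else 0)"
    by (intro sum.cong refl) (auto simp: L)
  also have "\<dots> = (\<Sum>b<?B. qform ?A G (slice ?A \<psi> b))"
    by (simp add: qform_def)
  also have "\<dots> = (\<Sum>b<?B. of_real (\<Sum>t<?A. l k (digit 4 t k) *
      (cmod (\<Sum>a<?A. slice ?A \<psi> b a * cnj (prod_vec 4 M v t a)))\<^sup>2))"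
    by (intro sum.cong refl qform_spectral) (simp add: G_def)
  also have "\<dots> = of_real (\<Sum>t<?A. l k (digit 4 t k) * (\<Sum>b<?B.
      (cmod (\<Sum>a<?A. slice ?A \<psi> b a * cnj (prod_vec 4 M v t a)))\<^sup>2))"
    unfolding of_real_sum[symmetric] sum_distrib_left by (subst sum.swap) (rule refl)
  finally show ?thesis .
qed

text \<open>A is read as \<open>M\<close> pairs of sites, and \<open>vn_entropy_blocks_le\<close> is
  applied with \<open>q = 4\<close> and the eigenbases of the blocks that start at the even sites
  \<open>2 * k\<close>.\<close>

lemma vn_entropy_ptrace_le:
  assumes M: "2 * M \<le> n" and \<psi>: "\<psi> \<in> carrier_vec (2 ^ n)"
    and norm: "(\<Sum>x<2 ^ n. (cmod (\<psi> $ x))\<^sup>2) = 1"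
    and op: "\<And>i. i < n \<Longrightarrow> opnorm (local_term n h1 h2 i) \<le> 1"
    and eps: "\<And>i. i < n \<Longrightarrow>
      Re (qform (2 ^ n) (\<lambda>r c. local_term n h1 h2 i $$ (r, c)) (\<lambda>x. \<psi> $ x)) = \<epsilon>"
  shows "vn_entropy (ptrace_B n (2 * M) (proj \<psi>)) \<le> real (2 * M) * ln 2 - real M * \<epsilon>\<^sup>2 / 2"
proof -
  let ?A = "4 ^ M :: nat" and ?B = "2 ^ (n - 2 * M) :: nat"
  let ?\<rho> = "ptrace_B n (2 * M) (proj \<psi>)"
  have "\<forall>j. \<exists>l v. eigen_family 4 (block h1 h2 (2 * j)) 4 l v"
    using hermitian_eigenbasis[OF herm_block] by metis
  then obtain l v where E: "\<And>j. eigen_family 4 (block h1 h2 (2 * j)) 4 (l j) (v j)"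
    by metis
  have pw: "(2::nat) ^ (2 * M) = ?A" by (simp add: power_mult)
  have n: "(2::nat) ^ n = ?A * ?B"
    unfolding pw[symmetric] using M by (simp flip: power_add)
  \<comment> \<open>The weight \<open>of_real 1\<close> puts the slice decomposition into the shape
    that \<open>qform_spectral\<close> expects.\<close>
  have \<rho>: "?\<rho> $$ (a, a') = (\<Sum>b<?B. of_real 1 * slice ?A \<psi> b a * cnj (slice ?A \<psi> b a'))"
    if "a < ?A" "a' < ?A" for a a'
    using ptrace_B_proj[OF \<psi> M, unfolded pw, OF that] by simp
  have qf: "Re (qform ?A (\<lambda>r s. ?\<rho> $$ (r, s)) x) =
      (\<Sum>b<?B. (cmod (\<Sum>a<?A. slice ?A \<psi> b a * cnj (x a)))\<^sup>2)" for x
  proof -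
    have "Re (qform ?A (\<lambda>r s. ?\<rho> $$ (r, s)) x) = (\<Sum>b<?B. 1 * (cmod (\<Sum>a<?A. x a * cnj (slice ?A \<psi> b a)))\<^sup>2)"
      by (subst qform_spectral[OF \<rho>]) simp_all
    also have "\<dots> = (\<Sum>b<?B. (cmod (\<Sum>a<?A. slice ?A \<psi> b a * cnj (x a)))\<^sup>2)"
      by (subst complex_mod_cnj[symmetric]) (simp add: mult.commute)
    finally show ?thesis .
  qed
  have "vn_entropy ?\<rho> \<le> real M * ln (real 4) - real M * \<epsilon>\<^sup>2 / 2"
  proof (rule vn_entropy_blocks_le)
    show "?\<rho> \<in> carrier_mat (4 ^ M) (4 ^ M)" by (simp add: ptrace_B_def pw)
    show "herm (4 ^ M) (\<lambda>r s. ?\<rho> $$ (r, s))"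
      by (intro hermI, simp only: \<rho>, simp add: mult.commute)
    show "0 \<le> Re (qform (4 ^ M) (\<lambda>r s. ?\<rho> $$ (r, s)) x)" for x
      by (simp add: qf sum_nonneg)
    have "(\<Sum>r<4 ^ M. ?\<rho> $$ (r, r)) = (\<Sum>r<?A. \<Sum>b<?B. of_real ((cmod (slice ?A \<psi> b r))\<^sup>2))"
      by (simp add: \<rho> complex_norm_square del: of_real_power)
    also have "\<dots> = of_real (\<Sum>x<2 ^ n. (cmod (\<psi> $ x))\<^sup>2)"
      unfolding n sum_lessThan_mult of_real_sum slice_def by (rule sum.swap)
    finally show "(\<Sum>r<4 ^ M. ?\<rho> $$ (r, r)) = 1" by (simp add: norm)
    fix k assume k: "k < M"
    show "orthonormal_family 4 4 (v k)" using E by (simp add: eigen_family_def)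
    show "\<bar>l k s\<bar> \<le> 1" if "s < 4" for s
      using k M by (intro block_eigenvalue_le[OF _ E that op]) auto
    have "(\<Sum>s<4. complex_of_real (l k s)) = (\<Sum>r<4. \<Sum>s<4. of_real (l k s) * (v k s r * cnj (v k s r)))"
      using orthonormal_familyD[OF conjunct1[OF E[unfolded eigen_family_def]]]
      by (subst sum.swap) (simp flip: sum_distrib_left)
    also have "\<dots> = (\<Sum>r<4. block h1 h2 (2 * k) r r)"
      using eigen_family_spectral[OF E[of k]] by (simp add: mult.assoc)
    finally show "(\<Sum>s<4. l k s) = 0"
      unfolding block_trace by (metis of_real_eq_0_iff of_real_sum)
    \<comment> \<open>The expectation of the block term in the reduced state and that of the local
      term in \<open>\<psi>\<close> are the same sum over labels and slices.\<close>
    show "(\<Sum>t<4 ^ M. l k (digit 4 t k) *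
        Re (qform (4 ^ M) (\<lambda>r s. ?\<rho> $$ (r, s)) (prod_vec 4 M v t))) = \<epsilon>"
      using eps[of "2 * k"] k M by (simp add: qf qform_local_term[OF k M E])
  qed simp
  also have "ln (real 4) = 2 * ln 2"
    using ln_realpow[of 2 2] by simp
  finally show ?thesis by simp
qed

section \<open>Translation\<close>

lemma digit_sum:
  assumes "\<And>j. j < n \<Longrightarrow> d j < q"
  shows "(\<Sum>j<n. d j * q ^ j) < q ^ n \<and> (\<forall>j<n. digit q (\<Sum>j<n. d j * q ^ j) j = d j)"
  using assms
proof (induction n)
  case (Suc n)
  let ?S = "\<Sum>j<n. d j * q ^ j"
  have S: "?S < q ^ n" and IH: "\<And>j. j < n \<Longrightarrow> digit q ?S j = d j" and dn: "d n < q"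
    using Suc by auto
  have sum: "(\<Sum>j<Suc n. d j * q ^ j) = ?S + q ^ n * d n" by (simp add: mult.commute)
  have "?S + q ^ n * d n < q ^ n * Suc (d n)" using S by simp
  also have "\<dots> \<le> q ^ n * q" using dn by (intro mult_left_mono) auto
  finally have "?S + q ^ n * d n < q ^ Suc n" by (simp add: mult.commute)
  moreover have "digit q (?S + q ^ n * d n) n = d n"
    using digit_add_high[OF S, of "d n" 0] dn by (simp add: digit_def)
  ultimately show ?case
    unfolding sum using IH by (auto simp: less_Suc_eq digit_add_low)
qed simp

lemma shift_digits:
  assumes n: "n > 0"
  shows "shift n x < 2 ^ n" and "k < n \<Longrightarrow> digit 2 (shift n x) ((k + 1) mod n) = digit 2 x k"
proof -
  \<comment> \<open>Adding \<open>n - 1\<close> modulo \<open>n\<close> is the step back to the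
    previous site, free of truncated subtraction at site 0.\<close>
  define d where "d j = digit 2 x ((j + (n - 1)) mod n)" for j
  have inv: "((k + 1) mod n + (n - 1)) mod n = k" if "k < n" for k
  proof (cases "Suc k = n")
    case False
    then have "Suc k < n" "Suc k + (n - 1) = k + n" using that by simp_all
    then show ?thesis using that by (simp only: Suc_eq_plus1[symmetric] mod_less mod_add_self2)
  qed auto
  have inv': "((j + (n - 1)) mod n + 1) mod n = j" if "j < n" for j
    using that n by (simp add: mod_simps)
  have bij: "bij_betw (\<lambda>k. (k + 1) mod n) {..<n} {..<n}"
    by (rule bij_betw_byWitness[where f' = "\<lambda>j. (j + (n - 1)) mod n"])
      (use inv inv' n in auto)
  have "shift n x = (\<Sum>k<n. d ((k + 1) mod n) * 2 ^ ((k + 1) mod n))"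
    unfolding shift_def using inv by (simp add: d_def qbit_eq_digit)
  also have "\<dots> = (\<Sum>j<n. d j * 2 ^ j)"
    using sum.reindex_bij_betw[OF bij, of "\<lambda>j. d j * 2 ^ j"] .
  finally have s: "shift n x = (\<Sum>j<n. d j * 2 ^ j)" .
  have ds: "(\<Sum>j<n. d j * 2 ^ j) < 2 ^ n \<and> (\<forall>j<n. digit 2 (\<Sum>j<n. d j * 2 ^ j) j = d j)"
    by (rule digit_sum) (simp add: d_def digit_less)
  then show "shift n x < 2 ^ n" by (simp add: s)
  show "digit 2 (shift n x) ((k + 1) mod n) = digit 2 x k" if "k < n"
    using ds inv[OF that] n by (simp add: s d_def)
qed

lemma bij_betw_shift:
  assumes "n > 0"
  shows "bij_betw (shift n) {..<2 ^ n} {..<2 ^ n}"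
proof -
  have "inj_on (shift n) {..<2 ^ n}"
  proof (rule inj_onI)
    fix x y assume xy: "x \<in> {..<2 ^ n}" "y \<in> {..<2 ^ n}" "shift n x = shift n y"
    show "x = y"
      by (rule digit_eqI[of _ 2 n]) (use xy shift_digits(2)[OF assms] in \<open>metis lessThan_iff\<close>)+
  qed
  moreover have "shift n ` {..<2 ^ n} \<subseteq> {..<2 ^ n}"
    using shift_digits(1)[OF assms] by auto
  ultimately show ?thesis
    by (simp add: bij_betw_def endo_inj_surj)
qed

text \<open>Conjugation by a permutation matrix relabels rows and columns. Reading the entries at
  shifted indices avoids an inverse of \<open>shift\<close>.\<close>

lemma transl_conj_index:
  assumes n: "n > 0" and K: "K \<in> carrier_mat (2 ^ n) (2 ^ n)" and rc: "r < 2 ^ n" "c < 2 ^ n"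
  shows "(transl n * K * transl_inv n) $$ (shift n r, shift n c) = K $$ (r, c)"
proof -
  note sh = shift_digits(1)[OF n]
  have inj: "shift n a = shift n b \<longleftrightarrow> a = b" if "a < 2 ^ n" "b < 2 ^ n" for a b
    using bij_betw_shift[OF n] that by (auto simp: bij_betw_def inj_on_def)
  have 1: "(transl n * K) $$ (shift n r, b) = K $$ (r, b)" if b: "b < 2 ^ n" for b
  proof -
    have "(transl n * K) $$ (shift n r, b) =
        (\<Sum>a<2 ^ n. (if shift n r = shift n a then 1 else 0) * K $$ (a, b))"
      using K b sh by (simp add: transl_def scalar_prod_def atLeast0LessThan)
    also have "\<dots> = (\<Sum>a<2 ^ n. if r = a then K $$ (a, b) else 0)"
      using inj rc by (intro sum.cong) auto
    finally show ?thesis using rc by simp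
  qed
  have "(transl n * K * transl_inv n) $$ (shift n r, shift n c) =
      row (transl n * K) (shift n r) \<bullet> col (transl_inv n) (shift n c)"
    using K sh by (intro index_mult_mat) (auto simp: transl_def transl_inv_def)
  also have "\<dots> = (\<Sum>b<2 ^ n. (transl n * K) $$ (shift n r, b) * transl_inv n $$ (b, shift n c))"
    unfolding scalar_prod_def atLeast0LessThan
    using K sh by (intro sum.cong) (auto simp: transl_def transl_inv_def)
  also have "\<dots> = (\<Sum>b<2 ^ n. if c = b then K $$ (r, b) else 0)"
    using inj rc sh by (intro sum.cong) (auto simp: 1 transl_inv_def)
  finally show ?thesis using rc by simp
qed

text \<open>Shifting the coordinates of a translation eigenvector costs a factor \<open>c\<close>,
  of modulus 1 since \<open>shift\<close> permutes coordinates and preserves the norm. It cancels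
  against its conjugate in the quadratic form.\<close>

lemma qform_transl_conj:
  assumes n: "n > 0" and K: "K \<in> carrier_mat (2 ^ n) (2 ^ n)" and \<psi>: "\<psi> \<in> carrier_vec (2 ^ n)"
    and norm: "(\<Sum>x<2 ^ n. (cmod (\<psi> $ x))\<^sup>2) = 1"
    and c: "transl n *\<^sub>v \<psi> = c \<cdot>\<^sub>v \<psi>"
  shows "qform (2 ^ n) (\<lambda>r s. (transl n * K * transl_inv n) $$ (r, s)) (\<lambda>x. \<psi> $ x) =
    qform (2 ^ n) (\<lambda>r s. K $$ (r, s)) (\<lambda>x. \<psi> $ x)"
proof -
  note sh = shift_digits(1)[OF n]
  note bij = bij_betw_shift[OF n]
  have inj: "shift n a = shift n b \<longleftrightarrow> a = b" if "a < 2 ^ n" "b < 2 ^ n" for a b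
    using bij that by (auto simp: bij_betw_def inj_on_def)
  have \<psi>s: "\<psi> $ r = c * \<psi> $ shift n r" if r: "r < 2 ^ n" for r
  proof -
    have "(transl n *\<^sub>v \<psi>) $ shift n r = (\<Sum>a<2 ^ n. (if shift n r = shift n a then 1 else 0) * \<psi> $ a)"
      using \<psi> sh by (simp add: transl_def scalar_prod_def atLeast0LessThan)
    also have "\<dots> = (\<Sum>a<2 ^ n. if r = a then \<psi> $ a else 0)"
      using inj r by (intro sum.cong) auto
    also have "\<dots> = \<psi> $ r" using r by simp
    finally show ?thesis using c \<psi> sh by simp
  qed
  have "(\<Sum>x<2 ^ n. (cmod (\<psi> $ x))\<^sup>2) = (cmod c)\<^sup>2 * (\<Sum>x<2 ^ n. (cmod (\<psi> $ shift n x))\<^sup>2)"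
    by (simp add: \<psi>s norm_mult power_mult_distrib sum_distrib_left)
  also have "(\<Sum>x<2 ^ n. (cmod (\<psi> $ shift n x))\<^sup>2) = (\<Sum>x<2 ^ n. (cmod (\<psi> $ x))\<^sup>2)"
    using sum.reindex_bij_betw[OF bij] .
  finally have c1: "cnj c * c = 1"
    using norm by (metis complex_norm_square mult.commute mult.right_neutral of_real_1)
  have re: "(\<Sum>r<2 ^ n. f r) = (\<Sum>r<2 ^ n. f (shift n r))" for f :: "nat \<Rightarrow> complex"
    using sum.reindex_bij_betw[OF bij] by metis
  have "qform (2 ^ n) (\<lambda>r s. (transl n * K * transl_inv n) $$ (r, s)) (\<lambda>x. \<psi> $ x) =
     (\<Sum>r<2 ^ n. \<Sum>s<2 ^ n. cnj (\<psi> $ shift n r) * K $$ (r, s) * \<psi> $ shift n s)"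
    unfolding qform_def by (subst re, subst (2) re) (simp add: transl_conj_index[OF n K])
  also have "\<dots> = (\<Sum>r<2 ^ n. \<Sum>s<2 ^ n. cnj (\<psi> $ r) * K $$ (r, s) * \<psi> $ s)"
  proof (intro sum.cong refl)
    fix r s :: nat assume "r \<in> {..<2 ^ n}" "s \<in> {..<2 ^ n}"
    then have "cnj (\<psi> $ r) * K $$ (r, s) * \<psi> $ s =
        cnj c * c * (cnj (\<psi> $ shift n r) * K $$ (r, s) * \<psi> $ shift n s)"
      using \<psi>s[of r] \<psi>s[of s] by simp
    then show "cnj (\<psi> $ shift n r) * K $$ (r, s) * \<psi> $ shift n s = cnj (\<psi> $ r) * K $$ (r, s) * \<psi> $ s"
      by (simp only: c1 mult_1_left)
  qed
  finally show ?thesis by (simp add: qform_def)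
qed

definition trace_prod :: "nat \<Rightarrow> complex mat \<Rightarrow> complex mat \<Rightarrow> complex" where
  "trace_prod N K L = (\<Sum>r<N. \<Sum>c<N. K $$ (r, c) * L $$ (c, r))"

lemma trace_prod_transl_conj:
  assumes n: "n > 0" and K: "K \<in> carrier_mat (2 ^ n) (2 ^ n)"
  shows "trace_prod (2 ^ n) (transl n * K * transl_inv n) (transl n * K * transl_inv n) =
    trace_prod (2 ^ n) K K"
proof -
  have re: "(\<Sum>r<2 ^ n. f r) = (\<Sum>r<2 ^ n. f (shift n r))" for f :: "nat \<Rightarrow> complex"
    using sum.reindex_bij_betw[OF bij_betw_shift[OF n]] by metis
  show ?thesis
    unfolding trace_prod_def by (subst re, subst (2) re) (simp add: transl_conj_index[OF n K])
qed

section \<open>Averaging over the eigenbasis\<close>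

text \<open>The trace of a product of strings factorizes over sites, and a site with a Pauli matrix
  from one string and the identity from the other contributes 0.\<close>

lemma tensor_trace_pstring_orth:
  assumes "i < n" "i' < n" and "a < 3" "a' < 3"
    and alone: "i \<notin> {i', j'} \<or> i' \<notin> {i, j}"
  shows "(\<Sum>r<2 ^ n. \<Sum>c<2 ^ n. tensor_op n (pstring i a j b) r c * tensor_op n (pstring i' a' j' b') c r) = 0"
proof -
  let ?f = "\<lambda>k. \<Sum>s<2. \<Sum>d<2. pstring i a j b k s d * pstring i' a' j' b' k d s"
  have "(\<Sum>r<2 ^ n. \<Sum>c<2 ^ n. tensor_op n (pstring i a j b) r c * tensor_op n (pstring i' a' j' b') c r) = (\<Prod>k<n. ?f k)"
    unfolding tensor_op_mult by (rule tensor_op_trace)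
  moreover have "\<exists>k<n. ?f k = 0"
    using alone
  proof
    assume "i \<notin> {i', j'}"
    then have "?f i = (\<Sum>s<2. pauli' a s s)"
      by (simp add: pstring_def sum_2)
    then show ?thesis using pauli'_trace[OF \<open>a < 3\<close>] assms by (auto simp: sum_2)
  next
    assume "i' \<notin> {i, j}"
    then have "?f i' = (\<Sum>s<2. pauli' a' s s)"
      by (simp add: pstring_def sum_2)
    then show ?thesis using pauli'_trace[OF \<open>a' < 3\<close>] assms by (auto simp: sum_2)
  qed
  ultimately show ?thesis by (auto intro: prod_zero)
qed

text \<open>Each string has a proper Pauli matrix at the first site of its bond. Two bonds that each
  contain the other's first site would need \<open>i' = i + 1\<close> and \<open>i = i' + 1\<close>
  modulo \<open>n\<close>, so \<open>n\<close> would divide 2.\<close>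

lemma trace_prod_local_term_orth:
  assumes n: "n \<ge> 3" and i: "i < n" "i' < n" "i \<noteq> i'"
  shows "trace_prod (2 ^ n) (local_term n h1 h2 i) (local_term n h1 h2 i') = 0"
proof -
  define j where "j = (i + 1) mod n"
  define j' where "j' = (i' + 1) mod n"
  have alone: "i \<notin> {i', j'} \<or> i' \<notin> {i, j}"
    using n i by (auto simp: j_def j'_def mod_Suc split: if_splits)
  let ?T = "\<lambda>a b. tensor_op n (pstring i a j b)" and ?T' = "\<lambda>a b. tensor_op n (pstring i' a j' b)"
  have "trace_prod (2 ^ n) (local_term n h1 h2 i) (local_term n h1 h2 i') =
    (\<Sum>r<2 ^ n. \<Sum>c<2 ^ n. (\<Sum>a<3. \<Sum>b<4. lcoef h1 h2 i a b * ?T a b r c) *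
       (\<Sum>a<3. \<Sum>b<4. lcoef h1 h2 i' a b * ?T' a b c r))"
    using n i by (simp add: trace_prod_def local_term_eq_tensor_op flip: j_def[simplified] j'_def[simplified])
  also have "\<dots> = (\<Sum>r<2 ^ n. \<Sum>c<2 ^ n. \<Sum>x\<in>{..<3} \<times> {..<4}. \<Sum>y\<in>{..<3} \<times> {..<4}.
      lcoef h1 h2 i (fst x) (snd x) * lcoef h1 h2 i' (fst y) (snd y) *
      (?T (fst x) (snd x) r c * ?T' (fst y) (snd y) c r))"
    by (simp only: sum.cartesian_product sum_product) (simp add: case_prod_unfold mult_ac)
  also have "\<dots> = (\<Sum>x\<in>{..<3} \<times> {..<4}. \<Sum>y\<in>{..<3} \<times> {..<4}. \<Sum>r<2 ^ n. \<Sum>c<2 ^ n. 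
      lcoef h1 h2 i (fst x) (snd x) * lcoef h1 h2 i' (fst y) (snd y) *
      (?T (fst x) (snd x) r c * ?T' (fst y) (snd y) c r))"
    by (simp only: sum.swap[of _ "{..<3} \<times> {..<4}" "{..<2 ^ n}"])
  also have "\<dots> = 0"
  proof (rule sum.neutral, rule ballI, rule sum.neutral, rule ballI)
    fix x y :: "nat \<times> nat"
    assume xy: "x \<in> {..<3} \<times> {..<4}" "y \<in> {..<3} \<times> {..<4}"
    have "fst x < 3" "fst y < 3" using xy by auto
    then show "(\<Sum>r<2 ^ n. \<Sum>c<2 ^ n.
      lcoef h1 h2 i (fst x) (snd x) * lcoef h1 h2 i' (fst y) (snd y) *
      (?T (fst x) (snd x) r c * ?T' (fst y) (snd y) c r)) = 0"
      using tensor_trace_pstring_orth[OF i(1,2) _ _ alone, of "fst x" "fst y"]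
      by (simp flip: sum_distrib_left)
  qed
  finally show ?thesis .
qed

text \<open>The trace is independent of the orthonormal basis, by completeness.\<close>

lemma sum_qform_orthonormal:
  assumes "orthonormal_family N N u"
  shows "(\<Sum>j<N. qform N a (u j)) = (\<Sum>r<N. a r r)"
proof -
  have "(\<Sum>j<N. qform N a (u j)) = (\<Sum>j<N. \<Sum>r<N. \<Sum>s<N. a r s * (u j s * cnj (u j r)))"
    by (simp add: qform_def mult_ac)
  also have "\<dots> = (\<Sum>r<N. \<Sum>s<N. a r s * (\<Sum>j<N. u j s * cnj (u j r)))"
    unfolding sum_distrib_left by (subst sum.swap, intro sum.cong refl sum.swap)
  also have "\<dots> = (\<Sum>r<N. \<Sum>s<N. if s = r then a r s else 0)"
    using orthonormal_family_complete[OF assms] by (intro sum.cong refl) auto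
  finally show ?thesis by simp
qed

lemma trace_prod_sum:
  assumes "\<And>r c. r < N \<Longrightarrow> c < N \<Longrightarrow> H $$ (r, c) = (\<Sum>i<n. L i $$ (r, c))"
  shows "trace_prod N H H = (\<Sum>i<n. \<Sum>i'<n. trace_prod N (L i) (L i'))"
proof -
  have "trace_prod N H H = (\<Sum>r<N. \<Sum>c<N. \<Sum>x\<in>{..<n} \<times> {..<n}. L (fst x) $$ (r, c) * L (snd x) $$ (c, r))"
    using assms by (simp add: trace_prod_def sum_product sum.cartesian_product case_prod_unfold)
  also have "\<dots> = (\<Sum>x\<in>{..<n} \<times> {..<n}. trace_prod N (L (fst x)) (L (snd x)))"
    unfolding trace_prod_def by (simp only: sum.swap[of _ "{..<n} \<times> {..<n}" "{..<N}"])
  finally show ?thesis by (simp add: sum.cartesian_product case_prod_unfold)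
qed

lemma qform_eigenvector:
  assumes "\<And>r. r < N \<Longrightarrow> (\<Sum>c<N. a r c * x c) = e * x r"
    and "(\<Sum>r<N. x r * cnj (x r)) = 1"
  shows "qform N a x = e" and "qform N (\<lambda>r d. \<Sum>c<N. a r c * a c d) x = e\<^sup>2"
proof -
  have *: "(\<Sum>r<N. cnj (x r) * (k * x r)) = k" for k
    using assms(2) by (simp add: mult_ac flip: sum_distrib_left)
  then show "qform N a x = e" by (simp add: qform_apply assms(1))
  have "(\<Sum>d<N. (\<Sum>c<N. a r c * a c d) * x d) = e\<^sup>2 * x r" if "r < N" for r
  proof -
    have "(\<Sum>d<N. (\<Sum>c<N. a r c * a c d) * x d) = (\<Sum>c<N. a r c * (\<Sum>d<N. a c d * x d))"
      unfolding sum_distrib_left sum_distrib_right mult.assoc by (rule sum.swap)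
    also have "\<dots> = (\<Sum>c<N. e * (a r c * x c))" by (simp add: assms(1) mult.left_commute)
    also have "\<dots> = e\<^sup>2 * x r" by (simp add: assms(1) that power2_eq_square flip: sum_distrib_left)
    finally show ?thesis .
  qed
  then show "qform N (\<lambda>r d. \<Sum>c<N. a r c * a c d) x = e\<^sup>2"
    using * by (simp add: qform_apply)
qed

lemma qform_sum:
  assumes "\<And>r c. r < N \<Longrightarrow> c < N \<Longrightarrow> a r c = (\<Sum>i<n. b i r c)"
  shows "qform N a x = (\<Sum>i<n. qform N (b i) x)"
proof -
  have "qform N a x = (\<Sum>r<N. \<Sum>c<N. \<Sum>i<n. cnj (x r) * b i r c * x c)"
    using assms by (simp add: qform_def sum_distrib_left sum_distrib_right)
  also have "\<dots> = (\<Sum>r<N. \<Sum>i<n. \<Sum>c<N. cnj (x r) * b i r c * x c)"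
    by (intro sum.cong refl sum.swap)
  also have "\<dots> = (\<Sum>i<n. qform N (b i) x)"
    unfolding qform_def by (rule sum.swap)
  finally show ?thesis .
qed

theorem theorem2:
  fixes n m :: nat
    and h1 :: "nat \<Rightarrow> nat \<Rightarrow> real"
    and h2 :: "nat \<Rightarrow> nat \<Rightarrow> nat \<Rightarrow> real"
    and \<psi> :: "nat \<Rightarrow> complex vec"
  assumes n2: "n \<ge> 2"
    and transl_inv: "\<forall>i<n. local_term n h1 h2 ((i + 1) mod n)
                        = transl n * local_term n h1 h2 i * transl_inv n"
    and norm1: "\<forall>i<n. opnorm (local_term n h1 h2 i) = 1"
    and dim: "\<forall>j<2 ^ n. \<psi> j \<in> carrier_vec (2 ^ n)"
    and orthonormal: "\<forall>j<2 ^ n. \<forall>j'<2 ^ n.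
          (\<Sum>k<2 ^ n. \<psi> j $ k * cnj (\<psi> j' $ k)) = (if j = j' then 1 else 0)"
    and eigen: "\<forall>j<2 ^ n. \<exists>E. total_ham n h1 h2 *\<^sub>v \<psi> j = E \<cdot>\<^sub>v \<psi> j"
    and tinv: "\<forall>j<2 ^ n. \<exists>c. transl n *\<^sub>v \<psi> j = c \<cdot>\<^sub>v \<psi> j"
    and m_even: "even m"
    and f_half: "real m / real n \<le> 1 / 2"
  shows "(1 / 2 ^ n) * (\<Sum>j<2 ^ n. vn_entropy (ptrace_B n m (proj (\<psi> j))))
           \<le> real m * ln 2
             - (real m / real n) * Re (inf_temp n (local_term n h1 h2 0 * local_term n h1 h2 0)) / 4"
proof -
  let ?N = "2 ^ n :: nat"
  let ?L = "local_term n h1 h2"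
  have n0: "n > 0" using n2 by simp
  obtain M where mM: "m = 2 * M" using m_even by blast
  have M: "2 * m \<le> n"
  proof -
    have "real (2 * m) \<le> real n" using f_half n0 by (simp add: field_simps)
    then show ?thesis by (simp only: of_nat_le_iff)
  qed
  have on: "orthonormal_family ?N ?N (\<lambda>j x. \<psi> j $ x)"
    using orthonormal by (simp add: orthonormal_family_def)
  have step: "qform ?N (\<lambda>r c. ?L ((i + 1) mod n) $$ (r, c)) (\<lambda>x. \<psi> j $ x) = qform ?N (\<lambda>r c. ?L i $$ (r, c)) (\<lambda>x. \<psi> j $ x)"
    if ij: "i < n" "j < ?N" for i j
  proof -
    obtain c where "transl n *\<^sub>v \<psi> j = c \<cdot>\<^sub>v \<psi> j" using tinv ij by blast
    then show ?thesis
      using qform_transl_conj[OF n0, of "?L i" "\<psi> j" c] orthonormal_family_norm[OF on ij(2)] dim transl_inv ij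
      by simp
  qed
  \<comment> \<open>Translate from site 0 one site at a time; \<open>Suc i < n\<close> keeps clear
    of the wrap-around.\<close>
  have const: "qform ?N (\<lambda>r c. ?L i $$ (r, c)) (\<lambda>x. \<psi> j $ x) = qform ?N (\<lambda>r c. ?L 0 $$ (r, c)) (\<lambda>x. \<psi> j $ x)"
    if "i < n" "j < ?N" for i j
    using that(1)
  proof (induction i)
    case (Suc i)
    then show ?case using step[of i j] that(2) by simp
  qed simp
  have const_tr: "trace_prod ?N (?L i) (?L i) = trace_prod ?N (?L 0) (?L 0)" if "i < n" for i
    using that
  proof (induction i)
    case (Suc i)
    then have "?L (Suc i) = transl n * ?L i * transl_inv n"
      using transl_inv by (metis Suc_eq_plus1 Suc_lessD mod_less)
    then show ?case using Suc trace_prod_transl_conj[OF n0, of "?L i"] by simp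
  qed simp
  define \<epsilon> where "\<epsilon> j = Re (qform ?N (\<lambda>r c. ?L 0 $$ (r, c)) (\<lambda>x. \<psi> j $ x))" for j
  \<comment> \<open>The coefficient \<open>1 / 4\<close> arises from \<open>M = m / 2\<close> pairs
    contributing \<open>(\<epsilon> j)\<^sup>2 / 2\<close> each.\<close>
  have S: "vn_entropy (ptrace_B n m (proj (\<psi> j))) \<le> real m * ln 2 - real m / 4 * (\<epsilon> j)\<^sup>2" if j: "j < ?N" for j
  proof -
    have "vn_entropy (ptrace_B n (2 * M) (proj (\<psi> j))) \<le> real (2 * M) * ln 2 - real M * (\<epsilon> j)\<^sup>2 / 2"
    proof (rule vn_entropy_ptrace_le)
      show "2 * M \<le> n" using M mM by simp
      show "\<psi> j \<in> carrier_vec ?N" using dim j by simp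
      show "(\<Sum>x<?N. (cmod (\<psi> j $ x))\<^sup>2) = 1" using orthonormal_family_norm[OF on j] .
      show "opnorm (?L i) \<le> 1" if "i < n" for i using norm1 that by simp
      show "Re (qform ?N (\<lambda>r c. ?L i $$ (r, c)) (\<lambda>x. \<psi> j $ x)) = \<epsilon> j" if "i < n" for i
        unfolding \<epsilon>_def const[OF that j] ..
    qed
    then show ?thesis by (simp add: mM)
  qed
  have avg: "(1 / 2 ^ n) * (\<Sum>j<?N. vn_entropy (ptrace_B n m (proj (\<psi> j)))) \<le>
      real m * ln 2 - real m / 4 * ((\<Sum>j<?N. (\<epsilon> j)\<^sup>2) / 2 ^ n)"
  proof -
    have "(\<Sum>j<?N. vn_entropy (ptrace_B n m (proj (\<psi> j)))) \<le> (\<Sum>j<?N. real m * ln 2 - real m / 4 * (\<epsilon> j)\<^sup>2)"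
      using S by (intro sum_mono) auto
    also have "\<dots> = 2 ^ n * (real m * ln 2) - real m / 4 * (\<Sum>j<?N. (\<epsilon> j)\<^sup>2)"
      by (simp add: sum_subtractf sum_distrib_left)
    finally show ?thesis by (simp add: field_simps)
  qed
  show ?thesis
  proof (cases "M = 0")
    case True
    then show ?thesis using avg by (simp add: mM)
  next
    case False
    \<comment> \<open>On two sites the bonds \<open>(1,2)\<close> and \<open>(2,1)\<close> coincide and the local terms need not be
      orthogonal; a nonempty even \<open>A\<close> of at most half the chain rules this out.\<close>
    then have n3: "n \<ge> 3" using M mM by simp
    define H where "H r c = total_ham n h1 h2 $$ (r, c)" for r c
    have H: "H r c = (\<Sum>i<n. ?L i $$ (r, c))" if "r < ?N" "c < ?N" for r c
      using that by (simp add: H_def total_ham_def)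
    \<comment> \<open>The energy eigenvalue is the sum of \<open>n\<close> equal local expectation
      values, hence \<open>real n * \<epsilon> j\<close>.\<close>
    have energy: "qform ?N (\<lambda>r d. \<Sum>c<?N. H r c * H c d) (\<lambda>x. \<psi> j $ x) = of_real ((real n * \<epsilon> j)\<^sup>2)" if j: "j < ?N" for j
    proof -
      obtain e where e: "total_ham n h1 h2 *\<^sub>v \<psi> j = e \<cdot>\<^sub>v \<psi> j" using eigen j by blast
      have "dim_vec (\<psi> j) = ?N" using dim j by auto
      have Hpsi: "(\<Sum>c<?N. H r c * \<psi> j $ c) = e * \<psi> j $ r" if "r < ?N" for r
      proof -
        have "(total_ham n h1 h2 *\<^sub>v \<psi> j) $ r = (\<Sum>c<?N. H r c * \<psi> j $ c)"
          using that dim j by (auto simp: H_def total_ham_def scalar_prod_def atLeast0LessThan)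
        then show ?thesis using e that \<open>dim_vec (\<psi> j) = ?N\<close> by simp
      qed
      note ev = qform_eigenvector[of ?N H "\<lambda>x. \<psi> j $ x" e, OF Hpsi]
      have norm: "(\<Sum>r<?N. \<psi> j $ r * cnj (\<psi> j $ r)) = 1"
        using orthonormal j by simp
      have "\<exists>l v. eigen_family 4 (block h1 h2 (2 * i)) 4 l v" for i
        using hermitian_eigenbasis[OF herm_block] by metis
      then obtain l v where E: "\<And>i. eigen_family 4 (block h1 h2 (2 * i)) 4 (l i) (v i)"
        by metis
      \<comment> \<open>Reality of the local expectation is read off from the block decomposition of
        the first pair, which exists because \<open>M > 0\<close>.\<close>
      have real: "qform ?N (\<lambda>r c. ?L 0 $$ (r, c)) (\<lambda>x. \<psi> j $ x) = of_real (\<epsilon> j)"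
        using qform_local_term[of 0 M n h1 h2 l v "\<psi> j", OF _ _ E] False M mM by (simp add: \<epsilon>_def)
      have "e = qform ?N H (\<lambda>x. \<psi> j $ x)" using ev(1) norm by simp
      also have "\<dots> = (\<Sum>i<n. qform ?N (\<lambda>r c. ?L i $$ (r, c)) (\<lambda>x. \<psi> j $ x))"
        by (rule qform_sum[OF H])
      also have "\<dots> = (\<Sum>i<n. of_real (\<epsilon> j))"
        by (intro sum.cong refl) (simp only: const[OF _ j] real lessThan_iff)
      also have "\<dots> = of_real (real n * \<epsilon> j)" by simp
      finally show ?thesis using ev(2) norm by simp
    qed
    \<comment> \<open>The trace of the squared Hamiltonian is computed twice: in the eigenbasis, and
      through the mutually orthogonal local terms.\<close>
    have "complex_of_real (\<Sum>j<?N. (real n * \<epsilon> j)\<^sup>2) = (\<Sum>j<?N. qform ?N (\<lambda>r d. \<Sum>c<?N. H r c * H c d) (\<lambda>x. \<psi> j $ x))"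
      by (simp add: energy)
    also have "\<dots> = trace_prod ?N (total_ham n h1 h2) (total_ham n h1 h2)"
      unfolding sum_qform_orthonormal[OF on] by (simp add: trace_prod_def H_def)
    also have "\<dots> = (\<Sum>i<n. \<Sum>i'<n. trace_prod ?N (?L i) (?L i'))"
      by (rule trace_prod_sum) (simp add: H[unfolded H_def])
    also have "\<dots> = (\<Sum>i<n. \<Sum>i'<n. if i = i' then trace_prod ?N (?L 0) (?L 0) else 0)"
    proof (intro sum.cong refl)
      fix i i' assume "i \<in> {..<n}" "i' \<in> {..<n}"
      then show "trace_prod ?N (?L i) (?L i') = (if i = i' then trace_prod ?N (?L 0) (?L 0) else 0)"
        using const_tr[of i] trace_prod_local_term_orth[OF n3, of i i'] by (cases "i = i'") simp_all
    qed
    also have "\<dots> = of_nat n * trace_prod ?N (?L 0) (?L 0)" by simp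
    also have "trace_prod ?N (?L 0) (?L 0) = 2 ^ n * inf_temp n (?L 0 * ?L 0)"
      by (simp add: inf_temp_def trace_prod_def scalar_prod_def atLeast0LessThan)
    also have "of_nat n * (2 ^ n * inf_temp n (?L 0 * ?L 0)) = of_real (real n * 2 ^ n) * inf_temp n (?L 0 * ?L 0)"
      by simp
    finally have "(\<Sum>j<?N. (real n * \<epsilon> j)\<^sup>2) = Re (of_real (real n * 2 ^ n) * inf_temp n (?L 0 * ?L 0))"
      by (metis Re_complex_of_real)
    also have "\<dots> = real n * (2 ^ n * Re (inf_temp n (?L 0 * ?L 0)))"
      by (simp only: times_complex.sel Re_complex_of_real Im_complex_of_real mult_zero_left diff_zero mult.assoc)
    also have "(\<Sum>j<?N. (real n * \<epsilon> j)\<^sup>2) = real n * (real n * (\<Sum>j<?N. (\<epsilon> j)\<^sup>2))"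
      by (simp add: power_mult_distrib power2_eq_square[of "real n"] sum_distrib_left mult.assoc)
    finally have "real n * (real n * (\<Sum>j<?N. (\<epsilon> j)\<^sup>2)) = real n * (2 ^ n * Re (inf_temp n (?L 0 * ?L 0)))" .
    then have "real n * (\<Sum>j<?N. (\<epsilon> j)\<^sup>2) = 2 ^ n * Re (inf_temp n (?L 0 * ?L 0))"
      using n0 by simp
    then have "(\<Sum>j<?N. (\<epsilon> j)\<^sup>2) / 2 ^ n = Re (inf_temp n (?L 0 * ?L 0)) / real n"
      using n0 by (simp add: field_simps)
    then show ?thesis using avg by (simp add: field_simps)
  qed
qed

end
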